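(* Let $K$ be a number field and $X$ a projective variety over $K$. Let $f,g\colon X\to X$ be surjective morphisms over $K$ and $Y\subset X$ a closed subvariety. Suppose (1) $f\circ g=g\circ f$; (2) $f(g(Y))=Y$; (3) $Y\cap g^n(Y)\subsetneq Y$ for all $n\ge 1$; (4) $Y(K)$ is Zariski dense in $Y$. Then there is no $s_0\in\mathbb{Z}_{\ge 0}$ such that for all $s\ge s_0$, $$\Bigl(f^{-s-1}(Y)\smallsetminus\bigcup_{0\le i\le s}f^{-i}(Y)\Bigr)(K)=\emptyset .$$
   Context: A projective variety over $K$ is an integral projective scheme over $K$; a closed subvariety is an irreducible reduced closed subscheme. $g^n$ denotes the $n$-th iterate, and $f^{-i}(Y)$ the preimage of $Y$ under the $i$-th iterate $f^i$. *)

theory Defs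
  imports
    "HOL-Algebra.Algebra"
    "HOL-Algebra.Algebraic_Closure_Type"
    "HOL-Analysis.Abstract_Topology"
begin

text \<open>This notation would make \<open>X\<close> unusable as the name of a variable.\<close>

no_notation var (\<open>X\<index>\<close>)

section \<open>Locally ringed spaces\<close>

text \<open>\<open>sections X U\<close> is the ring of sections over \<open>U\<close> and \<open>restriction X U V\<close> is the restriction
  map from \<open>U\<close> to \<open>V\<close>; both are meaningful only for open sets \<open>V \<subseteq> U\<close>.\<close>

record ('p, 'r) ringed_space =
  top_space :: "'p topology"
  sections :: "'p set \<Rightarrow> 'r ring"
  restriction :: "'p set \<Rightarrow> 'p set \<Rightarrow> 'r \<Rightarrow> 'r"

abbreviation points :: "('p, 'r) ringed_space \<Rightarrow> 'p set" where
  "points X \<equiv> topspace (top_space X)"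

abbreviation open_in :: "('p, 'r) ringed_space \<Rightarrow> 'p set \<Rightarrow> bool" where
  "open_in X \<equiv> openin (top_space X)"

definition presheaf_of_rings :: "('p, 'r) ringed_space \<Rightarrow> bool" where
  "presheaf_of_rings X \<longleftrightarrow>
     (\<forall>U. open_in X U \<longrightarrow> cring (sections X U)) \<and>
     (\<forall>U V. open_in X U \<and> open_in X V \<and> V \<subseteq> U \<longrightarrow>
        restriction X U V \<in> ring_hom (sections X U) (sections X V)) \<and>
     (\<forall>U. open_in X U \<longrightarrow> (\<forall>s\<in>carrier (sections X U). restriction X U U s = s)) \<and>
     (\<forall>U V W. open_in X U \<and> open_in X V \<and> open_in X W \<and> W \<subseteq> V \<and> V \<subseteq> U \<longrightarrow>
        (\<forall>s\<in>carrier (sections X U).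
           restriction X V W (restriction X U V s) = restriction X U W s))"

text \<open>The empty cover of the empty set is allowed, so that the ring of sections over the empty
  set is forced to be the zero ring.\<close>

definition sheaf_of_rings :: "('p, 'r) ringed_space \<Rightarrow> bool" where
  "sheaf_of_rings X \<longleftrightarrow> presheaf_of_rings X \<and>
     (\<forall>\<U>. (\<forall>U\<in>\<U>. open_in X U) \<longrightarrow>
        (\<forall>s\<in>carrier (sections X (\<Union>\<U>)). \<forall>t\<in>carrier (sections X (\<Union>\<U>)).
           (\<forall>U\<in>\<U>. restriction X (\<Union>\<U>) U s = restriction X (\<Union>\<U>) U t) \<longrightarrow> s = t) \<and>
        (\<forall>\<sigma>. (\<forall>U\<in>\<U>. \<sigma> U \<in> carrier (sections X U)) \<and>
             (\<forall>U\<in>\<U>. \<forall>V\<in>\<U>. restriction X U (U \<inter> V) (\<sigma> U) = restriction X V (U \<inter> V) (\<sigma> V)) \<longrightarrow>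
             (\<exists>s\<in>carrier (sections X (\<Union>\<U>)). \<forall>U\<in>\<U>. restriction X (\<Union>\<U>) U s = \<sigma> U)))"

definition germ :: "('p, 'r) ringed_space \<Rightarrow> 'p \<Rightarrow> 'p set \<Rightarrow> 'r \<Rightarrow> ('p set \<times> 'r) set" where
  "germ X p U s = {(V, t). open_in X V \<and> p \<in> V \<and> t \<in> carrier (sections X V) \<and>
     (\<exists>W. open_in X W \<and> p \<in> W \<and> W \<subseteq> U \<inter> V \<and> restriction X U W s = restriction X V W t)}"

text \<open>The unions run over the representatives of the germs; all of them give the same germ.\<close>

definition stalk :: "('p, 'r) ringed_space \<Rightarrow> 'p \<Rightarrow> (('p set \<times> 'r) set) ring" where
  "stalk X p =
     \<lparr> carrier = {germ X p U s |U s. open_in X U \<and> p \<in> U \<and> s \<in> carrier (sections X U)},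
       monoid.mult = (\<lambda>c d. \<Union>(U, s)\<in>c. \<Union>(V, t)\<in>d. germ X p (U \<inter> V)
                (restriction X U (U \<inter> V) s \<otimes>\<^bsub>sections X (U \<inter> V)\<^esub> restriction X V (U \<inter> V) t)),
       one = germ X p (points X) \<one>\<^bsub>sections X (points X)\<^esub>,
       ring.zero = germ X p (points X) \<zero>\<^bsub>sections X (points X)\<^esub>,
       add = (\<lambda>c d. \<Union>(U, s)\<in>c. \<Union>(V, t)\<in>d. germ X p (U \<inter> V)
                (restriction X U (U \<inter> V) s \<oplus>\<^bsub>sections X (U \<inter> V)\<^esub> restriction X V (U \<inter> V) t)) \<rparr>"

definition local_ring :: "'a ring \<Rightarrow> bool" where
  "local_ring R \<longleftrightarrow> cring R \<and> (\<exists>!m. maximalideal m R)"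

definition local_hom :: "'a ring \<Rightarrow> 'b ring \<Rightarrow> ('a \<Rightarrow> 'b) \<Rightarrow> bool" where
  "local_hom R S h \<longleftrightarrow> h \<in> ring_hom R S \<and>
     (\<forall>m n. maximalideal m R \<and> maximalideal n S \<longrightarrow> {a \<in> carrier R. h a \<in> n} = m)"

definition locally_ringed_space :: "('p, 'r) ringed_space \<Rightarrow> bool" where
  "locally_ringed_space X \<longleftrightarrow> sheaf_of_rings X \<and> (\<forall>p\<in>points X. local_ring (stalk X p))"

text \<open>A morphism from \<open>X\<close> to \<open>Y\<close> consists of the map on points and, for each open \<open>V\<close> of \<open>Y\<close>,
  the map \<open>mor_sec \<phi> V\<close> from the sections of \<open>Y\<close> over \<open>V\<close> to those of \<open>X\<close> over the preimage of \<open>V\<close>.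
  Only the values on actual points, open sets and sections matter, hence \<open>mor_eq\<close> below.\<close>

record ('p, 'r, 'q, 't) lrs_mor =
  mor_pt :: "'p \<Rightarrow> 'q"
  mor_sec :: "'q set \<Rightarrow> 't \<Rightarrow> 'r"

definition preim :: "('p, 'r) ringed_space \<Rightarrow> ('p \<Rightarrow> 'q) \<Rightarrow> 'q set \<Rightarrow> 'p set" where
  "preim X h Z = {p \<in> points X. h p \<in> Z}"

definition stalk_map ::
  "('p, 'r) ringed_space \<Rightarrow> ('p, 'r, 'q, 't) lrs_mor \<Rightarrow> 'p \<Rightarrow> ('q set \<times> 't) set \<Rightarrow> ('p set \<times> 'r) set" where
  "stalk_map X \<phi> p c = (\<Union>(V, t)\<in>c. germ X p (preim X (mor_pt \<phi>) V) (mor_sec \<phi> V t))"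

definition lrs_morphism ::
  "('p, 'r) ringed_space \<Rightarrow> ('q, 't) ringed_space \<Rightarrow> ('p, 'r, 'q, 't) lrs_mor \<Rightarrow> bool" where
  "lrs_morphism X Y \<phi> \<longleftrightarrow>
     continuous_map (top_space X) (top_space Y) (mor_pt \<phi>) \<and>
     (\<forall>V. open_in Y V \<longrightarrow>
        mor_sec \<phi> V \<in> ring_hom (sections Y V) (sections X (preim X (mor_pt \<phi>) V))) \<and>
     (\<forall>V W. open_in Y V \<and> open_in Y W \<and> W \<subseteq> V \<longrightarrow> (\<forall>t\<in>carrier (sections Y V).
        mor_sec \<phi> W (restriction Y V W t) =
        restriction X (preim X (mor_pt \<phi>) V) (preim X (mor_pt \<phi>) W) (mor_sec \<phi> V t))) \<and>
     (\<forall>p\<in>points X. local_hom (stalk Y (mor_pt \<phi> p)) (stalk X p) (stalk_map X \<phi> p))"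

definition mor_eq ::
  "('p, 'r) ringed_space \<Rightarrow> ('q, 't) ringed_space \<Rightarrow>
     ('p, 'r, 'q, 't) lrs_mor \<Rightarrow> ('p, 'r, 'q, 't) lrs_mor \<Rightarrow> bool" where
  "mor_eq X Y \<phi> \<psi> \<longleftrightarrow>
     (\<forall>p\<in>points X. mor_pt \<phi> p = mor_pt \<psi> p) \<and>
     (\<forall>V. open_in Y V \<longrightarrow> (\<forall>t\<in>carrier (sections Y V). mor_sec \<phi> V t = mor_sec \<psi> V t))"

definition mor_id :: "('p, 'r, 'p, 'r) lrs_mor" where
  "mor_id = \<lparr> mor_pt = (\<lambda>p. p), mor_sec = (\<lambda>V s. s) \<rparr>"

text \<open>\<open>mor_comp Y \<psi> \<phi>\<close> is \<open>\<psi>\<close> after \<open>\<phi>\<close>, where \<open>Y\<close> is the target of \<open>\<phi>\<close> and the source of \<open>\<psi>\<close>.\<close>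

definition mor_comp ::
  "('q, 't) ringed_space \<Rightarrow> ('q, 't, 'u, 'v) lrs_mor \<Rightarrow> ('p, 'r, 'q, 't) lrs_mor \<Rightarrow>
     ('p, 'r, 'u, 'v) lrs_mor" where
  "mor_comp Y \<psi> \<phi> =
     \<lparr> mor_pt = mor_pt \<psi> \<circ> mor_pt \<phi>,
       mor_sec = (\<lambda>W. mor_sec \<phi> (preim Y (mor_pt \<psi>) W) \<circ> mor_sec \<psi> W) \<rparr>"

definition lrs_isomorphic :: "('p, 'r) ringed_space \<Rightarrow> ('q, 't) ringed_space \<Rightarrow> bool" where
  "lrs_isomorphic X Y \<longleftrightarrow>
     (\<exists>\<phi> \<psi>. lrs_morphism X Y \<phi> \<and> lrs_morphism Y X \<psi> \<and>
        mor_eq X X (mor_comp Y \<psi> \<phi>) mor_id \<and> mor_eq Y Y (mor_comp X \<phi> \<psi>) mor_id)"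

definition open_subspace :: "('p, 'r) ringed_space \<Rightarrow> 'p set \<Rightarrow> ('p, 'r) ringed_space" where
  "open_subspace X U = X \<lparr> top_space := subtopology (top_space X) U \<rparr>"


section \<open>Zariski topologies and sheaves of fractions\<close>

text \<open>The Zariski topology on a set \<open>P\<close> of prime ideals: the closed sets are those of the form
  \<open>V(E) = {p \<in> P. E \<subseteq> p}\<close> with \<open>E \<subseteq> H\<close>. For \<open>Spec R\<close>, \<open>H\<close> is all of \<open>R\<close>; for \<open>Proj R\<close> it is the set of
  homogeneous elements.\<close>

definition zariski :: "'a set set \<Rightarrow> 'a set \<Rightarrow> 'a set topology" where
  "zariski P H = topology (\<lambda>U. \<exists>E\<subseteq>H. U = {p \<in> P. \<not> E \<subseteq> p})"

lemma openin_zariski: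
  assumes P: "\<And>p. p \<in> P \<Longrightarrow> primeideal p R"
    and H: "H \<subseteq> carrier R" "\<And>a b. a \<in> H \<Longrightarrow> b \<in> H \<Longrightarrow> a \<otimes>\<^bsub>R\<^esub> b \<in> H"
  shows "openin (zariski P H) U \<longleftrightarrow> (\<exists>E\<subseteq>H. U = {p \<in> P. \<not> E \<subseteq> p})"
proof -
  have int: "\<exists>G\<subseteq>H. {p \<in> P. \<not> E \<subseteq> p} \<inter> {p \<in> P. \<not> F \<subseteq> p} = {p \<in> P. \<not> G \<subseteq> p}"
    if EF: "E \<subseteq> H" "F \<subseteq> H" for E F
  proof (intro exI conjI)
    let ?G = "{a \<otimes>\<^bsub>R\<^esub> b |a b. a \<in> E \<and> b \<in> F}"
    show "?G \<subseteq> H" using EF H(2) by blast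
    have "(\<not> E \<subseteq> p \<and> \<not> F \<subseteq> p) \<longleftrightarrow> \<not> ?G \<subseteq> p" if "p \<in> P" for p
    proof -
      interpret primeideal p R by (rule P[OF that])
      show ?thesis
      proof
        assume "\<not> E \<subseteq> p \<and> \<not> F \<subseteq> p"
        then obtain a b where ab: "a \<in> E" "a \<notin> p" "b \<in> F" "b \<notin> p" by blast
        with EF H(1) have "a \<in> carrier R" "b \<in> carrier R" by auto
        with ab I_prime have "a \<otimes>\<^bsub>R\<^esub> b \<notin> p" by blast
        with ab show "\<not> ?G \<subseteq> p" by blast
      next
        assume "\<not> ?G \<subseteq> p"
        then obtain a b where ab: "a \<in> E" "b \<in> F" "a \<otimes>\<^bsub>R\<^esub> b \<notin> p" by blast
        with EF H(1) have "a \<in> carrier R" "b \<in> carrier R" by auto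
        with ab I_l_closed I_r_closed show "\<not> E \<subseteq> p \<and> \<not> F \<subseteq> p" by blast
      qed
    qed
    then show "{p \<in> P. \<not> E \<subseteq> p} \<inter> {p \<in> P. \<not> F \<subseteq> p} = {p \<in> P. \<not> ?G \<subseteq> p}" by blast
  qed
  have un: "\<exists>E\<subseteq>H. \<Union>\<K> = {p \<in> P. \<not> E \<subseteq> p}"
    if "\<forall>U\<in>\<K>. \<exists>E\<subseteq>H. U = {p \<in> P. \<not> E \<subseteq> p}" for \<K>
  proof -
    from that obtain e where e: "\<And>U. U \<in> \<K> \<Longrightarrow> e U \<subseteq> H \<and> U = {p \<in> P. \<not> e U \<subseteq> p}"
      by metis
    have "\<Union>\<K> = {p \<in> P. \<not> (\<Union>(e ` \<K>)) \<subseteq> p}"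
    proof (intro equalityI subsetI)
      fix p assume "p \<in> \<Union>\<K>"
      then obtain U where "U \<in> \<K>" "p \<in> U" by blast
      with e[of U] show "p \<in> {p \<in> P. \<not> (\<Union>(e ` \<K>)) \<subseteq> p}" by blast
    next
      fix p assume "p \<in> {p \<in> P. \<not> (\<Union>(e ` \<K>)) \<subseteq> p}"
      then obtain U where "U \<in> \<K>" "p \<in> P" "\<not> e U \<subseteq> p" by blast
      with e[of U] show "p \<in> \<Union>\<K>" by blast
    qed
    moreover have "\<Union>(e ` \<K>) \<subseteq> H" using e by blast
    ultimately show ?thesis by blast
  qed
  have "istopology (\<lambda>U. \<exists>E\<subseteq>H. U = {p \<in> P. \<not> E \<subseteq> p})"
    unfolding istopology_def
  proof (intro conjI allI impI)
    fix S T
    assume "\<exists>E\<subseteq>H. S = {p \<in> P. \<not> E \<subseteq> p}" "\<exists>E\<subseteq>H. T = {p \<in> P. \<not> E \<subseteq> p}"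
    then obtain E F where "E \<subseteq> H" "S = {p \<in> P. \<not> E \<subseteq> p}" "F \<subseteq> H" "T = {p \<in> P. \<not> F \<subseteq> p}"
      by (elim exE conjE)
    with int[of E F] show "\<exists>E\<subseteq>H. S \<inter> T = {p \<in> P. \<not> E \<subseteq> p}" by simp
  next
    fix \<K>
    assume "\<forall>U\<in>\<K>. \<exists>E\<subseteq>H. U = {p \<in> P. \<not> E \<subseteq> p}"
    then show "\<exists>E\<subseteq>H. \<Union>\<K> = {p \<in> P. \<not> E \<subseteq> p}" by (rule un)
  qed
  then show ?thesis
    unfolding zariski_def by (simp add: topology_inverse')
qed

text \<open>\<open>frac R T a s\<close> is the class of the fraction \<open>a/s\<close> in the localization of \<open>R\<close> at the
  multiplicative set \<open>T\<close>.\<close>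

definition frac :: "'a ring \<Rightarrow> 'a set \<Rightarrow> 'a \<Rightarrow> 'a \<Rightarrow> ('a \<times> 'a) set" where
  "frac R T a s = {(b, t). b \<in> carrier R \<and> t \<in> T \<and>
     (\<exists>u\<in>T. u \<otimes>\<^bsub>R\<^esub> (t \<otimes>\<^bsub>R\<^esub> a \<ominus>\<^bsub>R\<^esub> s \<otimes>\<^bsub>R\<^esub> b) = \<zero>\<^bsub>R\<^esub>)}"

definition localization :: "'a ring \<Rightarrow> 'a set \<Rightarrow> (('a \<times> 'a) set) ring" where
  "localization R T =
     \<lparr> carrier = {frac R T a s |a s. a \<in> carrier R \<and> s \<in> T},
       monoid.mult = (\<lambda>c d. \<Union>(a, s)\<in>c. \<Union>(b, t)\<in>d. frac R T (a \<otimes>\<^bsub>R\<^esub> b) (s \<otimes>\<^bsub>R\<^esub> t)),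
       one = frac R T \<one>\<^bsub>R\<^esub> \<one>\<^bsub>R\<^esub>,
       ring.zero = frac R T \<zero>\<^bsub>R\<^esub> \<one>\<^bsub>R\<^esub>,
       add = (\<lambda>c d. \<Union>(a, s)\<in>c. \<Union>(b, t)\<in>d.
                frac R T (t \<otimes>\<^bsub>R\<^esub> a \<oplus>\<^bsub>R\<^esub> s \<otimes>\<^bsub>R\<^esub> b) (s \<otimes>\<^bsub>R\<^esub> t)) \<rparr>"

text \<open>The common part of the structure sheaves of \<open>Spec\<close> and \<open>Proj\<close>: a section over \<open>U\<close> assigns to
  each \<open>p \<in> U\<close> an element of the localization of \<open>R\<close> at \<open>M p\<close>, and it is locally given by one fraction
  \<open>a/b\<close> with \<open>(a, b) \<in> D\<close>. The operations are pointwise.\<close>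

definition fraction_space ::
  "'a ring \<Rightarrow> 'a set topology \<Rightarrow> ('a set \<Rightarrow> 'a set) \<Rightarrow> ('a \<times> 'a) set \<Rightarrow>
     ('a set, 'a set \<Rightarrow> ('a \<times> 'a) set) ringed_space" where
  "fraction_space R T M D =
     \<lparr> top_space = T,
       sections = (\<lambda>U.
         \<lparr> carrier = {s \<in> extensional U. \<forall>p\<in>U. \<exists>V. openin T V \<and> p \<in> V \<and> V \<subseteq> U \<and>
                       (\<exists>(a, b)\<in>D. \<forall>q\<in>V. b \<in> M q \<and> s q = frac R (M q) a b)},
           monoid.mult = (\<lambda>s t. \<lambda>q\<in>U. s q \<otimes>\<^bsub>localization R (M q)\<^esub> t q),
           one = (\<lambda>q\<in>U. \<one>\<^bsub>localization R (M q)\<^esub>),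
           ring.zero = (\<lambda>q\<in>U. \<zero>\<^bsub>localization R (M q)\<^esub>),
           add = (\<lambda>s t. \<lambda>q\<in>U. s q \<oplus>\<^bsub>localization R (M q)\<^esub> t q) \<rparr>),
       restriction = (\<lambda>U V s. restrict s V) \<rparr>"

definition Spec :: "'a ring \<Rightarrow> ('a set, 'a set \<Rightarrow> ('a \<times> 'a) set) ringed_space" where
  "Spec R = fraction_space R (zariski {p. primeideal p R} (carrier R)) (\<lambda>p. carrier R - p)
              (carrier R \<times> carrier R)"

text \<open>\<open>Proj R G\<close>, where \<open>G d\<close> is the homogeneous part of degree \<open>d\<close> of the graded ring \<open>R\<close>.
  An ideal is homogeneous iff it is generated by its homogeneous elements, and the sections are
  locally \<open>a/b\<close> with \<open>a\<close> and \<open>b\<close> homogeneous of the same degree.\<close>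

definition Proj_points :: "'a ring \<Rightarrow> (nat \<Rightarrow> 'a set) \<Rightarrow> 'a set set" where
  "Proj_points R G = {p. primeideal p R \<and> p = Idl\<^bsub>R\<^esub> (p \<inter> (\<Union>d. G d)) \<and> \<not> (\<Union>d\<in>{1..}. G d) \<subseteq> p}"

definition Proj ::
  "'a ring \<Rightarrow> (nat \<Rightarrow> 'a set) \<Rightarrow> ('a set, 'a set \<Rightarrow> ('a \<times> 'a) set) ringed_space" where
  "Proj R G = fraction_space R (zariski (Proj_points R G) (\<Union>d. G d)) (\<lambda>p. (\<Union>d. G d) - p)
                (\<Union>d. G d \<times> G d)"

text \<open>The morphism from \<open>Proj R\<close> to \<open>Spec A\<close> induced by a ring homomorphism \<open>h\<close> from \<open>A\<close> to the
  degree 0 part of \<open>R\<close>: it pulls back a section which is \<open>a/b\<close> at the image of \<open>p\<close> to one which is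
  \<open>h a/h b\<close> at \<open>p\<close>.\<close>

definition Proj_to_Spec ::
  "'a ring \<Rightarrow> (nat \<Rightarrow> 'a set) \<Rightarrow> 'b ring \<Rightarrow> ('b \<Rightarrow> 'a) \<Rightarrow>
     ('a set, 'a set \<Rightarrow> ('a \<times> 'a) set, 'b set, 'b set \<Rightarrow> ('b \<times> 'b) set) lrs_mor" where
  "Proj_to_Spec R G A h =
     (let \<pi> = (\<lambda>p. {a \<in> carrier A. h a \<in> p}) in
      \<lparr> mor_pt = \<pi>,
        mor_sec = (\<lambda>V s. \<lambda>p \<in> preim (Proj R G) \<pi> V.
                     \<Union>(a, b) \<in> s (\<pi> p). frac R ((\<Union>d. G d) - p) (h a) (h b)) \<rparr>)"


section \<open>Schemes\<close>

text \<open>It is no restriction that the rings \<open>R\<close> have elements of the type of the sections of \<open>X\<close>: if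
  \<open>U\<close> is affine then \<open>R\<close> can be taken to be \<open>sections X U\<close>.\<close>

definition scheme :: "('p, 'r) ringed_space \<Rightarrow> bool" where
  "scheme X \<longleftrightarrow> locally_ringed_space X \<and>
     (\<forall>p\<in>points X. \<exists>U. open_in X U \<and> p \<in> U \<and>
        (\<exists>R :: 'r ring. cring R \<and> lrs_isomorphic (open_subspace X U) (Spec R)))"

definition integral_scheme :: "('p, 'r) ringed_space \<Rightarrow> bool" where
  "integral_scheme X \<longleftrightarrow> scheme X \<and> points X \<noteq> {} \<and>
     (\<forall>U. open_in X U \<and> U \<noteq> {} \<longrightarrow> domain (sections X U))"

definition reduced_scheme :: "('p, 'r) ringed_space \<Rightarrow> bool" where
  "reduced_scheme X \<longleftrightarrow> scheme X \<and>
     (\<forall>U. open_in X U \<longrightarrow> (\<forall>s\<in>carrier (sections X U). \<forall>n::nat.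
        s [^]\<^bsub>sections X U\<^esub> n = \<zero>\<^bsub>sections X U\<^esub> \<longrightarrow> s = \<zero>\<^bsub>sections X U\<^esub>))"

definition irreducible_space :: "'p topology \<Rightarrow> bool" where
  "irreducible_space T \<longleftrightarrow> topspace T \<noteq> {} \<and>
     (\<forall>A B. closedin T A \<and> closedin T B \<and> topspace T = A \<union> B \<longrightarrow> A = topspace T \<or> B = topspace T)"

text \<open>The last condition is surjectivity, as a map of sheaves on \<open>X\<close>, of the map from the structure
  sheaf of \<open>X\<close> to the direct image of that of \<open>Z\<close>.\<close>

definition closed_immersion ::
  "('q, 't) ringed_space \<Rightarrow> ('p, 'r) ringed_space \<Rightarrow> ('q, 't, 'p, 'r) lrs_mor \<Rightarrow> bool" where
  "closed_immersion Z X j \<longleftrightarrow> lrs_morphism Z X j \<and>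
     embedding_map (top_space Z) (top_space X) (mor_pt j) \<and>
     closedin (top_space X) (mor_pt j ` points Z) \<and>
     (\<forall>V. open_in X V \<longrightarrow> (\<forall>s\<in>carrier (sections Z (preim Z (mor_pt j) V)). \<forall>p\<in>V.
        \<exists>W t. open_in X W \<and> p \<in> W \<and> W \<subseteq> V \<and> t \<in> carrier (sections X W) \<and>
          mor_sec j W t =
            restriction Z (preim Z (mor_pt j) V) (preim Z (mor_pt j) W) s))"

text \<open>The closed subscheme of \<open>X\<close> given by the closed immersion \<open>j\<close> is irreducible and reduced.\<close>

definition closed_subvariety ::
  "('p, 'r) ringed_space \<Rightarrow> ('q, 't) ringed_space \<Rightarrow> ('q, 't, 'p, 'r) lrs_mor \<Rightarrow> bool" where
  "closed_subvariety X Y j \<longleftrightarrow> closed_immersion Y X j \<and>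
     irreducible_space (top_space Y) \<and> reduced_scheme Y"


section \<open>Schemes over a field\<close>

definition number_field :: "'k ring \<Rightarrow> bool" where
  "number_field K \<longleftrightarrow> field K \<and>
     (\<exists>h\<in>ring_hom (ring_of_type_algebra :: rat ring) K.
        ring.finite_dimension K (range h) (carrier K))"

text \<open>A scheme over \<open>K\<close> is a scheme \<open>X\<close> with a structure morphism \<open>\<pi>\<close> from \<open>X\<close> to \<open>Spec K\<close>.\<close>

type_synonym ('p, 'r, 'k) structure_mor =
  "('p, 'r, 'k set, 'k set \<Rightarrow> ('k \<times> 'k) set) lrs_mor"

definition scheme_over ::
  "'k ring \<Rightarrow> ('p, 'r) ringed_space \<Rightarrow> ('p, 'r, 'k) structure_mor \<Rightarrow> bool" where
  "scheme_over K X \<pi> \<longleftrightarrow> scheme X \<and> lrs_morphism X (Spec K) \<pi>"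

definition morphism_over ::
  "'k ring \<Rightarrow> ('p, 'r) ringed_space \<Rightarrow> ('p, 'r, 'k) structure_mor \<Rightarrow>
     ('q, 't) ringed_space \<Rightarrow> ('q, 't, 'k) structure_mor \<Rightarrow> ('p, 'r, 'q, 't) lrs_mor \<Rightarrow> bool" where
  "morphism_over K X \<pi> Y \<rho> \<phi> \<longleftrightarrow> lrs_morphism X Y \<phi> \<and> mor_eq X (Spec K) (mor_comp Y \<rho> \<phi>) \<pi>"

text \<open>The polynomial ring over \<open>K\<close> in the variables \<open>x\<^sub>0, \<dots>, x\<^sub>n\<close>. As in
  \<open>HOL-Algebra.Indexed_Polynomials\<close>, a monomial is the multiset of the indices of its variables and
  a polynomial maps each monomial to its coefficient.\<close>

definition poly_ring_upto :: "'k ring \<Rightarrow> nat \<Rightarrow> (nat multiset \<Rightarrow> 'k) ring" where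
  "poly_ring_upto K n =
     \<lparr> carrier = ring.indexed_pset K {..n} (carrier K),
       monoid.mult = (\<lambda>P Q m. \<Oplus>\<^bsub>K\<^esub>a\<in>{a. a \<subseteq># m}. P a \<otimes>\<^bsub>K\<^esub> Q (m - a)),
       one = ring.indexed_const K \<one>\<^bsub>K\<^esub>,
       ring.zero = ring.indexed_const K \<zero>\<^bsub>K\<^esub>,
       add = ring.indexed_padd K \<rparr>"

definition forms :: "'k ring \<Rightarrow> nat \<Rightarrow> nat \<Rightarrow> (nat multiset \<Rightarrow> 'k) set" where
  "forms K n d = {P \<in> carrier (poly_ring_upto K n). \<forall>m. P m \<noteq> \<zero>\<^bsub>K\<^esub> \<longrightarrow> size m = d}"

type_synonym 'k Pn_point = "(nat multiset \<Rightarrow> 'k) set"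
type_synonym 'k Pn_section =
  "'k Pn_point \<Rightarrow> ((nat multiset \<Rightarrow> 'k) \<times> (nat multiset \<Rightarrow> 'k)) set"

definition projective_space :: "'k ring \<Rightarrow> nat \<Rightarrow> ('k Pn_point, 'k Pn_section) ringed_space" where
  "projective_space K n = Proj (poly_ring_upto K n) (forms K n)"

definition projective_space_mor ::
  "'k ring \<Rightarrow> nat \<Rightarrow> ('k Pn_point, 'k Pn_section, 'k) structure_mor" where
  "projective_space_mor K n =
     Proj_to_Spec (poly_ring_upto K n) (forms K n) K (ring.indexed_const K)"

definition projective_over ::
  "'k ring \<Rightarrow> ('p, 'r) ringed_space \<Rightarrow> ('p, 'r, 'k) structure_mor \<Rightarrow> bool" where
  "projective_over K X \<pi> \<longleftrightarrow> scheme_over K X \<pi> \<and>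
     (\<exists>n \<iota>. closed_immersion X (projective_space K n) \<iota> \<and>
        morphism_over K X \<pi> (projective_space K n) (projective_space_mor K n) \<iota>)"

definition projective_variety ::
  "'k ring \<Rightarrow> ('p, 'r) ringed_space \<Rightarrow> ('p, 'r, 'k) structure_mor \<Rightarrow> bool" where
  "projective_variety K X \<pi> \<longleftrightarrow> integral_scheme X \<and> projective_over K X \<pi>"

text \<open>The \<open>K\<close>-points of \<open>X\<close> are the sections over \<open>K\<close> of the structure morphism.\<close>

definition K_points ::
  "'k ring \<Rightarrow> ('p, 'r) ringed_space \<Rightarrow> ('p, 'r, 'k) structure_mor \<Rightarrow>
     ('k set, 'k set \<Rightarrow> ('k \<times> 'k) set, 'p, 'r) lrs_mor set" where
  "K_points K X \<pi> = {x. morphism_over K (Spec K) mor_id X \<pi> x}"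

text \<open>\<open>Z(K)\<close> for a locally closed subset \<open>Z\<close> of \<open>X\<close>. Since \<open>Spec K\<close> is reduced, a morphism from
  \<open>Spec K\<close> to \<open>X\<close> factors through a subscheme with underlying set \<open>Z\<close> iff its image lies in \<open>Z\<close>,
  whichever scheme structure \<open>Z\<close> carries.\<close>

definition K_points_in ::
  "'k ring \<Rightarrow> ('p, 'r) ringed_space \<Rightarrow> ('p, 'r, 'k) structure_mor \<Rightarrow> 'p set \<Rightarrow>
     ('k set, 'k set \<Rightarrow> ('k \<times> 'k) set, 'p, 'r) lrs_mor set" where
  "K_points_in K X \<pi> Z = {x \<in> K_points K X \<pi>. mor_pt x ` points (Spec K) \<subseteq> Z}"

definition K_points_dense ::
  "'k ring \<Rightarrow> ('p, 'r) ringed_space \<Rightarrow> ('p, 'r, 'k) structure_mor \<Rightarrow> bool" where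
  "K_points_dense K X \<pi> \<longleftrightarrow>
     top_space X closure_of (\<Union>x\<in>K_points K X \<pi>. mor_pt x ` points (Spec K)) = points X"

text \<open>The underlying set in \<open>X\<close> of the subscheme given by \<open>j\<close>.\<close>

definition subscheme_points :: "('q, 't) ringed_space \<Rightarrow> ('q, 't, 'p, 'r) lrs_mor \<Rightarrow> 'p set" where
  "subscheme_points Y j = mor_pt j ` points Y"

definition surjective_morphism ::
  "('p, 'r) ringed_space \<Rightarrow> ('q, 't) ringed_space \<Rightarrow> ('p, 'r, 'q, 't) lrs_mor \<Rightarrow> bool" where
  "surjective_morphism X Y \<phi> \<longleftrightarrow> mor_pt \<phi> ` points X = points Y"

end

theory Submission
  imports Defs "HOL-Library.Multiset_Order"
begin

text \<open>Write \<open>S\<close> for the set of points of \<open>Y\<close>. If \<open>y\<close> is a \<open>K\<close>-point of \<open>Y\<close>, then \<open>x = g\<^bsup>s+1\<^esup>(y)\<close> is a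
  \<open>K\<close>-point of \<open>X\<close> in \<open>f\<^bsup>-s-1\<^esup>(S)\<close>, because \<open>f(g(S)) = S\<close>. If the set in question has no \<open>K\<close>-points, then
  \<open>f\<^bsup>i\<^esup>(x) \<in> S\<close> for some \<open>i \<le> s\<close> that depends on \<open>y\<close>. As \<open>Y(K)\<close> is dense and \<open>Y\<close> is irreducible, one
  \<open>i\<close> works for all points of \<open>S\<close>, so that \<open>g\<^bsup>n\<^esup>(S) = f\<^bsup>i\<^esup>(g\<^bsup>s+1\<^esup>(S)) \<subseteq> S\<close> with \<open>n = s + 1 - i \<ge> 1\<close>. Since \<open>X\<close>
  is a Noetherian space this forces \<open>g\<^bsup>n\<^esup>(S) = S\<close>, which contradicts (3).\<close>

section \<open>Noetherian topological spaces\<close>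

text \<open>One stationary step is equivalent to eventual stationarity: a chain that never becomes
  constant has a strictly decreasing subsequence.\<close>

definition noetherian_topology :: "'a topology \<Rightarrow> bool" where
  "noetherian_topology T \<longleftrightarrow>
     (\<forall>C :: nat \<Rightarrow> 'a set. (\<forall>k. closedin T (C k) \<and> C (Suc k) \<subseteq> C k) \<longrightarrow> (\<exists>k. C (Suc k) = C k))"

lemma noetherian_topologyD:
  assumes "noetherian_topology T" "\<And>k. closedin T (C k)" "\<And>k. C (Suc k) \<subseteq> C k"
  obtains k :: nat where "C (Suc k) = C k"
  using assms unfolding noetherian_topology_def by blast

text \<open>A chain in \<open>T\<close> is pushed forward to closed sets of \<open>T'\<close>, and
  injectivity of \<open>h\<close> pulls the stationary step back. This carries the property from
  projective space to a projective variety.\<close>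

lemma noetherian_topology_closed_embedding:
  fixes T :: "'a topology"
  assumes "noetherian_topology T'" and emb: "embedding_map T T' h"
    and closed: "closedin T' (h ` topspace T)"
  shows "noetherian_topology T"
  unfolding noetherian_topology_def
proof (intro allI impI)
  fix C :: "nat \<Rightarrow> 'a set" assume C: "\<forall>k. closedin T (C k) \<and> C (Suc k) \<subseteq> C k"
  have "closed_map T T' h"
    using emb closed by (simp add: embedding_map_def closed_map_from_closed_subtopology
        homeomorphic_imp_closed_map)
  then have "closedin T' (h ` C k)" for k
    using C by (simp add: closed_map_def)
  moreover have "h ` C (Suc k) \<subseteq> h ` C k" for k
    using C by blast
  ultimately obtain k where "h ` C (Suc k) = h ` C k"
    using noetherian_topologyD[OF assms(1), of "\<lambda>k. h ` C k"] by blast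
  moreover have "inj_on h (topspace T)"
    using emb by (simp add: embedding_map_def homeomorphic_eq_everything_map)
  ultimately have "C (Suc k) = C k"
    using C by (meson closedin_subset inj_on_image_eq_iff)
  then show "\<exists>k. C (Suc k) = C k" ..
qed

section \<open>The Noetherian property of projective space\<close>

text \<open>Induction over the coordinates in \<open>I\<close>: thin out the subsequence found so
  far to one that is monotone at \<open>x\<close>, then drop an initial segment so that it is
  nondecreasing there.\<close>

lemma dickson_subseq:
  fixes f :: "nat \<Rightarrow> 'a multiset"
  assumes "finite I"
  shows "\<exists>r :: nat \<Rightarrow> nat. strict_mono r \<and>
           (\<forall>x\<in>I. \<forall>i j. i \<le> j \<longrightarrow> count (f (r i)) x \<le> count (f (r j)) x)"
  using assms
proof (induction I rule: finite_induct)
  case empty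
  show ?case by (rule exI[of _ id]) (auto simp: strict_mono_def)
next
  case (insert x I)
  obtain r :: "nat \<Rightarrow> nat" where r: "strict_mono r"
    "\<And>y i j. y \<in> I \<Longrightarrow> i \<le> j \<Longrightarrow> count (f (r i)) y \<le> count (f (r j)) y"
    using insert.IH by blast
  obtain s where s: "strict_mono s" "monoseq (\<lambda>n. count (f (r (s n))) x)"
    using seq_monosub[of "\<lambda>n. count (f (r n)) x"] by blast
  obtain N where N: "\<And>i j. N \<le> i \<Longrightarrow> i \<le> j \<Longrightarrow> count (f (r (s i))) x \<le> count (f (r (s j))) x"
  proof (cases "incseq (\<lambda>n. count (f (r (s n))) x)")
    case True
    then show thesis using that[of 0] by (auto simp: incseq_def)
  next
    case False
    then have dec: "decseq (\<lambda>n. count (f (r (s n))) x)" using s by (simp add: monoseq_iff)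
    \<comment> \<open>The least value is attained at some \<open>N\<close>; a decreasing sequence of
      naturals is constant from there on, hence nondecreasing.\<close>
    obtain N where "\<And>n. count (f (r (s N))) x \<le> count (f (r (s n))) x"
      using ex_has_least_nat[of "\<lambda>_. True" 0 "\<lambda>n. count (f (r (s n))) x"] by auto
    then show thesis using that[of N] dec unfolding decseq_def by (meson order_trans)
  qed
  show ?case
  proof (intro exI conjI ballI allI impI)
    show "strict_mono (\<lambda>i. r (s (N + i)))"
      using r(1) s(1) by (simp add: strict_mono_def)
    fix y i j assume y: "y \<in> insert x I" and ij: "(i::nat) \<le> j"
    have "s (N + i) \<le> s (N + j)" using s(1) ij by (simp add: strict_mono_less_eq)
    with y ij r(2) N[of "N + i" "N + j"]
    show "count (f (r (s (N + i)))) y \<le> count (f (r (s (N + j)))) y" by auto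
  qed
qed

lemma dickson:
  fixes f :: "nat \<Rightarrow> 'a multiset"
  assumes "finite I" "\<And>i. set_mset (f i) \<subseteq> I"
  obtains i j where "i < j" "f i \<subseteq># f j"
proof -
  obtain r :: "nat \<Rightarrow> nat" where r: "strict_mono r"
    "\<And>x i j. x \<in> I \<Longrightarrow> i \<le> j \<Longrightarrow> count (f (r i)) x \<le> count (f (r j)) x"
    using dickson_subseq[OF assms(1)] by blast
  have "f (r 0) \<subseteq># f (r 1)"
    unfolding subseteq_mset_def
  proof
    fix x
    show "count (f (r 0)) x \<le> count (f (r 1)) x"
      using r(2)[of x 0 1] assms(2)[of "r 0"] by (cases "x \<in># f (r 0)") (auto simp: not_in_iff)
  qed
  moreover have "r 0 < r 1" using r(1) by (simp add: strict_mono_def)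
  ultimately show thesis by (rule that[rotated])
qed

text \<open>Keeps the convolution sum in the product of \<open>poly_ring_upto\<close> finite;
  \<open>finsum\<close> over an infinite set is zero by convention.\<close>

lemma finite_submultisets: "finite {b. b \<subseteq># m}"
proof (induction m)
  case (add x m)
  have "{b. b \<subseteq># add_mset x m} \<subseteq> {b. b \<subseteq># m} \<union> add_mset x ` {b. b \<subseteq># m}"
  proof
    fix b assume "b \<in> {b. b \<subseteq># add_mset x m}"
    then have b: "b \<subseteq># add_mset x m" by simp
    show "b \<in> {b. b \<subseteq># m} \<union> add_mset x ` {b. b \<subseteq># m}"
    proof (cases "x \<in># b")
      case True
      then obtain b' where "b = add_mset x b'" by (blast dest: multi_member_split)
      with b show ?thesis by simp
    next
      case False
      have "b \<subseteq># m"
      proof (rule mset_subset_eqI)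
        fix y show "count b y \<le> count m y"
          using False mset_subset_eq_count[OF b, of y] by (cases "y = x") (simp_all add: not_in_iff)
      qed
      then show ?thesis by simp
    qed
  qed
  with add show ?case by (meson finite_UnI finite_imageI finite_subset)
qed simp

section \<open>Monomials and supports of polynomials\<close>

definition (in ring) indexed_monom :: "'a \<Rightarrow> 'c multiset \<Rightarrow> 'c multiset \<Rightarrow> 'a" where
  "indexed_monom c a = (\<lambda>m. if m = a then c else \<zero>)"

context ring
begin

lemma indexed_monom_in_pset:
  "c \<in> K \<Longrightarrow> set_mset a \<subseteq> I \<Longrightarrow> indexed_monom c a \<in> indexed_pset I K"
proof (induction a)
  case empty
  then show ?case
    using indexed_pset.indexed_const[of c K] by (simp add: indexed_monom_def indexed_const_def)
next
  case (add x a)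
  have "indexed_monom c (add_mset x a) = indexed_pmult (indexed_monom c a) x"
    by (rule ext) (auto simp: indexed_monom_def indexed_pmult_def dest: multi_member_split)
  with add show ?case by (auto intro: indexed_pset.indexed_pmult)
qed

text \<open>Both facts pass through the three generating rules of \<open>indexed_pset\<close>. They
  make a largest monomial exist and let Dickson's lemma run over finitely many variables.\<close>

lemma indexed_pset_monomials:
  assumes "P \<in> indexed_pset I (carrier R)"
  shows "finite {m. P m \<noteq> \<zero>}" and "P m \<noteq> \<zero> \<Longrightarrow> set_mset m \<subseteq> I"
proof -
  have "finite {m. P m \<noteq> \<zero>} \<and> (\<forall>m. P m \<noteq> \<zero> \<longrightarrow> set_mset m \<subseteq> I)"
    using assms
  proof induction
    case (indexed_const k)
    have "{m. indexed_const k m \<noteq> \<zero>} \<subseteq> {{#}}" by (auto simp: indexed_const_def)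
    then show ?case by (auto simp: indexed_const_def dest: finite_subset)
  next
    case (indexed_padd P Q)
    have "{m. indexed_padd P Q m \<noteq> \<zero>} \<subseteq> {m. P m \<noteq> \<zero>} \<union> {m. Q m \<noteq> \<zero>}"
      by (auto simp: indexed_padd_def)
    with indexed_padd show ?case by (auto intro: finite_subset)
  next
    case (indexed_pmult P i)
    have "{m. indexed_pmult P i m \<noteq> \<zero>} \<subseteq> add_mset i ` {m. P m \<noteq> \<zero>}"
    proof
      fix m assume "m \<in> {m. indexed_pmult P i m \<noteq> \<zero>}"
      then have "i \<in># m" "P (m - {#i#}) \<noteq> \<zero>"
        by (auto simp: indexed_pmult_def split: if_splits)
      then show "m \<in> add_mset i ` {m. P m \<noteq> \<zero>}"
        by (intro image_eqI[of _ _ "m - {#i#}"]) simp_all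
    qed
    moreover from this have "set_mset m \<subseteq> I" if "indexed_pmult P i m \<noteq> \<zero>" for m
      using that indexed_pmult by fastforce
    ultimately show ?case using indexed_pmult by (meson finite_imageI finite_subset)
  qed
  then show "finite {m. P m \<noteq> \<zero>}" and "P m \<noteq> \<zero> \<Longrightarrow> set_mset m \<subseteq> I" by auto
qed

end

section \<open>Hilbert's basis theorem by leading monomials\<close>

text \<open>The monomial order is the multiset order on \<open>nat multiset\<close>, a well-order
  compatible with addition. For the zero polynomial the value is unspecified.\<close>

definition lead_monomial :: "'k ring \<Rightarrow> (nat multiset \<Rightarrow> 'k) \<Rightarrow> nat multiset" where
  "lead_monomial K P = Max {m. P m \<noteq> \<zero>\<^bsub>K\<^esub>}"

context
  fixes K :: "'k ring" (structure)
  assumes K: "field K"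
begin

interpretation field K by (rule K)

lemma poly_ring_upto_coeff:
  "P \<in> carrier (poly_ring_upto K n) \<Longrightarrow> P m \<in> carrier K"
  using indexed_pset_in_carrier[of "carrier K" P "{..n}"]
  by (simp add: poly_ring_upto_def carrier_coeff_def)

text \<open>Only the summand of the convolution with index \<open>a\<close> can be nonzero, and it
  occurs exactly when \<open>a\<close> divides \<open>m\<close>.\<close>

lemma poly_ring_upto_mult_monom:
  assumes c: "c \<in> carrier K" and Q: "Q \<in> carrier (poly_ring_upto K n)"
  shows "(indexed_monom c a \<otimes>\<^bsub>poly_ring_upto K n\<^esub> Q) m = (if a \<subseteq># m then c \<otimes> Q (m - a) else \<zero>)"
proof -
  have coeff: "\<And>m. Q m \<in> carrier K" using Q by (rule poly_ring_upto_coeff)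
  have "(indexed_monom c a \<otimes>\<^bsub>poly_ring_upto K n\<^esub> Q) m
      = (\<Oplus>b\<in>{b. b \<subseteq># m}. if a = b then c \<otimes> Q (m - b) else \<zero>)"
    by (auto simp: poly_ring_upto_def indexed_monom_def intro!: finsum_cong' simp: c coeff)
  also have "\<dots> = (if a \<subseteq># m then c \<otimes> Q (m - a) else \<zero>)"
  proof (cases "a \<subseteq># m")
    case True
    then show ?thesis
      using finsum_singleton[of a "{b. b \<subseteq># m}" "\<lambda>b. c \<otimes> Q (m - b)"]
        finite_submultisets[of m] c coeff by simp
  next
    case False
    then have "(\<Oplus>b\<in>{b. b \<subseteq># m}. if a = b then c \<otimes> Q (m - b) else \<zero>) = (\<Oplus>b\<in>{b. b \<subseteq># m}. \<zero>)"
      by (intro finsum_cong') auto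
    with False show ?thesis by simp
  qed
  finally show ?thesis .
qed

lemma lead_monomial:
  assumes P: "P \<in> carrier (poly_ring_upto K n)" and nz: "P \<noteq> \<zero>\<^bsub>poly_ring_upto K n\<^esub>"
  shows "P (lead_monomial K P) \<noteq> \<zero>" and "P m \<noteq> \<zero> \<Longrightarrow> m \<le> lead_monomial K P"
proof -
  have fin: "finite {m. P m \<noteq> \<zero>}"
    using P indexed_pset_monomials(1) by (simp add: poly_ring_upto_def)
  have ne: "{m. P m \<noteq> \<zero>} \<noteq> {}"
    using nz by (auto simp: poly_ring_upto_def indexed_const_def)
  show "P (lead_monomial K P) \<noteq> \<zero>"
    using Max_in[OF fin ne] by (simp add: lead_monomial_def)
  show "P m \<noteq> \<zero> \<Longrightarrow> m \<le> lead_monomial K P"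
    using Max_ge[OF fin] by (simp add: lead_monomial_def)
qed

text \<open>One division step: adding a monomial multiple of \<open>Q\<close> cancels the leading
  term of \<open>P\<close> and creates no larger one. The conclusion speaks of coefficients because
  the result may be zero.\<close>

lemma lead_monomial_reduce:
  assumes P: "P \<in> carrier (poly_ring_upto K n)" "P \<noteq> \<zero>\<^bsub>poly_ring_upto K n\<^esub>"
    and Q: "Q \<in> carrier (poly_ring_upto K n)" "Q \<noteq> \<zero>\<^bsub>poly_ring_upto K n\<^esub>"
    and le: "lead_monomial K Q \<subseteq># lead_monomial K P"
  obtains M where "M \<in> carrier (poly_ring_upto K n)"
    and "\<And>m. lead_monomial K P \<le> m \<Longrightarrow>
           (P \<oplus>\<^bsub>poly_ring_upto K n\<^esub> M \<otimes>\<^bsub>poly_ring_upto K n\<^esub> Q) m = \<zero>"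
proof -
  define mp where "mp = lead_monomial K P"
  define mq where "mq = lead_monomial K Q"
  define a where "a = mp - mq"
  \<comment> \<open>Chosen so that \<open>c \<otimes> Q mq\<close> is the negative of
    \<open>P mp\<close>.\<close>
  define c where "c = \<ominus> (P mp \<otimes> inv (Q mq))"
  have le': "mq \<subseteq># mp" using le by (simp add: mp_def mq_def)
  have mpa: "mp - a = mq" "mp = a + mq" "a \<subseteq># mp"
    using le' by (simp_all add: a_def subset_mset.le_imp_diff_is_add subset_mset.diff_diff_right)
  have Pc: "\<And>m. P m \<in> carrier K" and Qc: "\<And>m. Q m \<in> carrier K"
    using P Q by (auto intro: poly_ring_upto_coeff)
  have Qu: "Q mq \<in> Units K"
    using lead_monomial(1)[OF Q] Qc by (simp add: field_Units mq_def)
  have c: "c \<in> carrier K" using Pc Qu by (simp add: c_def)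
  have am: "set_mset a \<subseteq> {..n}"
  proof -
    have "set_mset mp \<subseteq> {..n}"
      using lead_monomial(1)[OF P] P(1) indexed_pset_monomials(2)
      by (simp add: poly_ring_upto_def mp_def)
    then show ?thesis using mpa(3) by (meson set_mset_mono subset_trans)
  qed
  show thesis
  proof
    show "indexed_monom c a \<in> carrier (poly_ring_upto K n)"
      using indexed_monom_in_pset[OF c am] by (simp add: poly_ring_upto_def)
    fix m assume "lead_monomial K P \<le> m"
    then have m: "mp \<le> m" by (simp add: mp_def)
    have eq: "(P \<oplus>\<^bsub>poly_ring_upto K n\<^esub> indexed_monom c a \<otimes>\<^bsub>poly_ring_upto K n\<^esub> Q) m
        = P m \<oplus> (if a \<subseteq># m then c \<otimes> Q (m - a) else \<zero>)"
      unfolding poly_ring_upto_mult_monom[OF c Q(1), symmetric]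
      by (simp add: poly_ring_upto_def indexed_padd_def)
    show "(P \<oplus>\<^bsub>poly_ring_upto K n\<^esub> indexed_monom c a \<otimes>\<^bsub>poly_ring_upto K n\<^esub> Q) m = \<zero>"
    proof (cases "m = mp")
      case True
      have "c \<otimes> Q mq = \<ominus> P mp"
        using Qu Pc Qc by (simp add: c_def l_minus m_assoc Units_l_inv)
      then show ?thesis using eq True mpa Pc by (simp add: r_neg)
    next
      case False
      with m have lt: "mp < m" by simp
      have "P m = \<zero>" using lead_monomial(2)[OF P] lt mp_def by fastforce
      moreover have "Q (m - a) = \<zero>" if "a \<subseteq># m"
      proof -
        \<comment> \<open>Cancelling \<open>a\<close> in \<open>a + mq < a + (m - a)\<close> shows
          that \<open>m - a\<close> lies beyond the leading monomial of \<open>Q\<close>.\<close>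
        have "m = a + (m - a)" using that by simp
        with lt mpa(2) have "mq < m - a" by (metis add_less_cancel_left)
        then show ?thesis using lead_monomial(2)[OF Q] mq_def by fastforce
      qed
      ultimately show ?thesis using eq c by simp
    qed
  qed
qed

text \<open>Were the chain strictly increasing, choose \<open>p k\<close> in \<open>I (Suc k) - I k\<close> with least leading
  monomial. Dickson's lemma yields \<open>i < j\<close> such that \<open>p j\<close> can be reduced by \<open>p i\<close>, which
  contradicts the minimality of \<open>p j\<close>.\<close>

lemma poly_ring_upto_ideal_chain:
  fixes I :: "nat \<Rightarrow> (nat multiset \<Rightarrow> 'k) set"
  assumes "cring (poly_ring_upto K n)" and ideal: "\<And>k. ideal (I k) (poly_ring_upto K n)" and chain: "\<And>k. I k \<subseteq> I (Suc k)"
  shows "\<exists>k. I (Suc k) = I k"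
proof (rule ccontr)
  assume "\<not> ?thesis"
  then have ne: "\<exists>p. p \<in> I (Suc k) - I k" for k using chain[of k] by blast
  have "\<exists>p. p \<in> I (Suc k) - I k \<and>
      (\<forall>r \<in> I (Suc k) - I k. lead_monomial K p \<le> lead_monomial K r)" for k
  proof -
    let ?L = "\<lambda>m. \<exists>p \<in> I (Suc k) - I k. lead_monomial K p = m"
    have "\<exists>m. ?L m" using ne[of k] by blast
    then obtain p where p: "p \<in> I (Suc k) - I k" "lead_monomial K p = (LEAST m. ?L m)"
      using LeastI_ex[of ?L] by blast
    show ?thesis
      using p by (intro exI[of _ p] conjI ballI) (auto intro: Least_le)
  qed
  then obtain p where p: "\<And>k. p k \<in> I (Suc k) - I k"
    and min: "\<And>k r. r \<in> I (Suc k) - I k \<Longrightarrow> lead_monomial K (p k) \<le> lead_monomial K r"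
    by metis
  interpret P: cring "poly_ring_upto K n"
    by fact
  have sub: "I k \<subseteq> carrier (poly_ring_upto K n)" for k
    using additive_subgroup.a_subset[OF ideal.axioms(1)[OF ideal[of k]]] .
  have nz: "\<zero>\<^bsub>poly_ring_upto K n\<^esub> \<in> I k" for k
    using additive_subgroup.zero_closed[OF ideal.axioms(1)[OF ideal[of k]]] .
  have pc: "p k \<in> carrier (poly_ring_upto K n)" "p k \<noteq> \<zero>\<^bsub>poly_ring_upto K n\<^esub>" for k
    using p[of k] sub[of "Suc k"] nz[of k] by auto
  have "set_mset (lead_monomial K (p k)) \<subseteq> {..n}" for k
    using lead_monomial(1)[OF pc] pc(1)[of k]
    by (intro indexed_pset_monomials(2)[of "p k"]) (simp_all add: poly_ring_upto_def)
  then obtain i j where ij: "i < j" "lead_monomial K (p i) \<subseteq># lead_monomial K (p j)"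
    using dickson[of "{..n}" "\<lambda>k. lead_monomial K (p k)"] by blast
  obtain M where M: "M \<in> carrier (poly_ring_upto K n)"
    and van: "\<And>m. lead_monomial K (p j) \<le> m \<Longrightarrow>
           (p j \<oplus>\<^bsub>poly_ring_upto K n\<^esub> M \<otimes>\<^bsub>poly_ring_upto K n\<^esub> p i) m = \<zero>"
    using lead_monomial_reduce[OF pc pc ij(2)] by blast
  define t where "t = M \<otimes>\<^bsub>poly_ring_upto K n\<^esub> p i"
  define r where "r = p j \<oplus>\<^bsub>poly_ring_upto K n\<^esub> t"
  have mono: "I a \<subseteq> I b" if "a \<le> b" for a b
    using that chain by (rule lift_Suc_mono_le[rotated])
  \<comment> \<open>Since \<open>i < j\<close>, the reducing polynomial already lies in
    \<open>I j\<close>; hence \<open>p j\<close> changes by an element of \<open>I j\<close> and the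
    result \<open>r\<close> stays outside \<open>I j\<close>.\<close>
  have "p i \<in> I j" using p[of i] mono[of "Suc i" j] ij(1) by auto
  then have t: "t \<in> I j" unfolding t_def using ideal.I_l_closed[OF ideal] M by blast
  have tc: "t \<in> carrier (poly_ring_upto K n)" using t sub by blast
  have "r \<in> I (Suc j)"
    unfolding r_def using additive_subgroup.a_closed[OF ideal.axioms(1)[OF ideal]] p[of j] t chain[of j]
    by blast
  moreover have "r \<notin> I j"
  proof
    assume "r \<in> I j"
    then have "r \<oplus>\<^bsub>poly_ring_upto K n\<^esub> (\<ominus>\<^bsub>poly_ring_upto K n\<^esub> t) \<in> I j"
      using additive_subgroup.a_closed[OF ideal.axioms(1)[OF ideal]]
        additive_subgroup.a_inv_closed[OF ideal.axioms(1)[OF ideal]] t by simp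
    moreover have "r \<oplus>\<^bsub>poly_ring_upto K n\<^esub> (\<ominus>\<^bsub>poly_ring_upto K n\<^esub> t) = p j"
      using tc pc(1)[of j] by (simp add: r_def P.a_assoc P.r_neg)
    ultimately show False using p[of j] by simp
  qed
  ultimately have r: "r \<in> I (Suc j) - I j" by simp
  then have "r \<in> carrier (poly_ring_upto K n)" "r \<noteq> \<zero>\<^bsub>poly_ring_upto K n\<^esub>"
    using sub nz by auto
  \<comment> \<open>By minimality the leading monomial of \<open>r\<close> is at least that of
    \<open>p j\<close>, where the reduction made all coefficients vanish.\<close>
  then have "r (lead_monomial K r) \<noteq> \<zero>" by (rule lead_monomial(1))
  then show False using van[OF min[OF r]] by (simp add: r_def t_def)
qed

section \<open>The Zariski topology of projective space\<close>

text \<open>A nonzero summand of the convolution splits \<open>m\<close> into monomials of sizes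
  \<open>d\<close> and \<open>e\<close>. Closure of the homogeneous elements under products is what
  \<open>openin_zariski\<close> asks for.\<close>

lemma forms_mult_closed:
  assumes "cring (poly_ring_upto K n)" and P: "P \<in> forms K n d" and Q: "Q \<in> forms K n e"
  shows "P \<otimes>\<^bsub>poly_ring_upto K n\<^esub> Q \<in> forms K n (d + e)"
proof -
  interpret P: cring "poly_ring_upto K n" by fact
  have PQ: "P \<in> carrier (poly_ring_upto K n)" "Q \<in> carrier (poly_ring_upto K n)"
    using P Q by (auto simp: forms_def)
  have c: "\<And>m. P m \<in> carrier K" "\<And>m. Q m \<in> carrier K"
    using PQ by (auto intro: poly_ring_upto_coeff)
  have "size m = d + e" if "(P \<otimes>\<^bsub>poly_ring_upto K n\<^esub> Q) m \<noteq> \<zero>" for m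
  proof (rule ccontr)
    assume m: "size m \<noteq> d + e"
    have "P a \<otimes> Q (m - a) = \<zero>" if "a \<subseteq># m" for a
    proof (cases "P a = \<zero> \<or> Q (m - a) = \<zero>")
      case True then show ?thesis using c by auto
    next
      case False
      then have "size a = d" "size (m - a) = e" using P Q by (auto simp: forms_def)
      then show ?thesis using m that size_Diff_submset size_mset_mono by fastforce
    qed
    then have "(\<Oplus>a\<in>{a. a \<subseteq># m}. P a \<otimes> Q (m - a)) = (\<Oplus>a\<in>{a. a \<subseteq># m}. \<zero>)"
      by (intro finsum_cong') auto
    with that show False by (simp add: poly_ring_upto_def)
  qed
  then show ?thesis using PQ by (simp add: forms_def)
qed

text \<open>Vanishing ideals turn a descending chain of closed sets into an ascending chain of
  ideals, and each closed set is recovered from its ideal.\<close>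

lemma noetherian_projective_space: "noetherian_topology (top_space (projective_space K n))"
proof -
  define P where "P = Proj_points (poly_ring_upto K n) (forms K n)"
  define H where "H = (\<Union>d. forms K n d)"
  have T: "top_space (projective_space K n) = zariski P H"
    by (simp add: projective_space_def Proj_def fraction_space_def P_def H_def)
  have prime: "primeideal p (poly_ring_upto K n)" if "p \<in> P" for p
    using that by (simp add: P_def Proj_points_def)
  \<comment> \<open>Any point is a prime ideal, and \<open>primeideal\<close> includes that the
    ambient ring is a \<open>cring\<close>; this supplies the ring axioms. Without points the space
    is empty and the claim is trivial.\<close>
  show ?thesis
  proof (cases "P = {}")
    case True
    have "istopology (\<lambda>U::'k Pn_point set. U = {})" by (auto simp: istopology_def)
    moreover have "(\<lambda>U. \<exists>E\<subseteq>H. U = {p \<in> P. \<not> E \<subseteq> p}) = (\<lambda>U. U = {})"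
      using True by auto
    ultimately have "topspace (zariski P H) = {}"
      by (simp add: zariski_def topspace_def topology_inverse')
    then show ?thesis
      unfolding T noetherian_topology_def using closedin_subset by (metis subset_empty)
  next
    case False
    then obtain p0 where "p0 \<in> P" by blast
    then interpret P: cring "poly_ring_upto K n"
      using prime primeideal.axioms(2) by blast
    have HR: "H \<subseteq> carrier (poly_ring_upto K n)" by (auto simp: H_def forms_def)
    have Hm: "a \<otimes>\<^bsub>poly_ring_upto K n\<^esub> b \<in> H" if "a \<in> H" "b \<in> H" for a b
      using that forms_mult_closed[OF P.is_cring] unfolding H_def by blast
    have op: "openin (zariski P H) U \<longleftrightarrow> (\<exists>E\<subseteq>H. U = {p \<in> P. \<not> E \<subseteq> p})" for U
      using prime HR Hm by (rule openin_zariski)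
    have top: "topspace (zariski P H) = P"
    proof
      show "topspace (zariski P H) \<subseteq> P"
        using openin_topspace[of "zariski P H"] unfolding op by blast
      \<comment> \<open>No point of \<open>Proj\<close> contains all elements of positive degree,
        let alone all of \<open>H\<close>.\<close>
      have "P = {p \<in> P. \<not> H \<subseteq> p}"
        by (auto simp: P_def Proj_points_def H_def)
      then have "openin (zariski P H) P" using op by blast
      then show "P \<subseteq> topspace (zariski P H)" by (rule openin_subset)
    qed
    \<comment> \<open>Inserting the carrier makes the ideal of the empty set the whole ring instead
      of \<open>UNIV\<close>.\<close>
    define I where "I Z = \<Inter>(insert (carrier (poly_ring_upto K n)) Z)" for Z
    have ideal: "ideal (I Z) (poly_ring_upto K n)" if "Z \<subseteq> P" for Z
      unfolding I_def using that prime primeideal.axioms(1) P.oneideal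
      by (intro P.i_Intersect) auto
    have VI: "Z = {p \<in> P. I Z \<subseteq> p}" if Z: "closedin (zariski P H) Z" for Z
    proof -
      have "Z \<subseteq> P" using Z top closedin_subset by blast
      obtain E where E: "E \<subseteq> H" "P - Z = {p \<in> P. \<not> E \<subseteq> p}"
        using Z op top by (auto simp: closedin_def)
      then have "E \<subseteq> I Z" using HR \<open>Z \<subseteq> P\<close> by (auto simp: I_def)
      then have "p \<in> Z" if "p \<in> P" "I Z \<subseteq> p" for p
        using E(2) that by blast
      moreover have "I Z \<subseteq> p" if "p \<in> Z" for p using that by (auto simp: I_def)
      ultimately show ?thesis using \<open>Z \<subseteq> P\<close> by blast
    qed
    show ?thesis
      unfolding T noetherian_topology_def
    proof (intro allI impI)
      fix C :: "nat \<Rightarrow> 'k Pn_point set"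
      assume C: "\<forall>k. closedin (zariski P H) (C k) \<and> C (Suc k) \<subseteq> C k"
      then have "ideal (I (C k)) (poly_ring_upto K n)" for k
        using ideal top closedin_subset by metis
      moreover have "I (C k) \<subseteq> I (C (Suc k))" for k
        using C by (auto simp: I_def)
      ultimately obtain k where "I (C (Suc k)) = I (C k)"
        using poly_ring_upto_ideal_chain[OF P.is_cring, of "\<lambda>k. I (C k)"] by blast
      then have "C (Suc k) = C k" using VI C by metis
      then show "\<exists>k. C (Suc k) = C k" ..
    qed
  qed
qed

end


section \<open>Commuting maps on a Noetherian space\<close>

lemma continuous_map_funpow:
  "continuous_map T T f \<Longrightarrow> continuous_map T T (f ^^ n)"
  by (induction n) (auto intro: continuous_map_compose)

text \<open>Split off one set at a time; the empty union is excluded because an irreducible space is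
  nonempty.\<close>

lemma irreducible_space_finite_Union:
  assumes irr: "irreducible_space T" and "finite I"
    and "\<And>i. i \<in> I \<Longrightarrow> closedin T (A i)" "topspace T = (\<Union>i\<in>I. A i)"
  shows "\<exists>i\<in>I. A i = topspace T"
  using assms(2-)
proof (induction I rule: finite_induct)
  case empty
  then show ?case using irr by (simp add: irreducible_space_def)
next
  case (insert i I)
  let ?B = "\<Union>i\<in>I. A i"
  have "closedin T ?B" using insert by (intro closedin_Union) auto
  moreover have "topspace T = A i \<union> ?B" using insert.prems(2) by simp
  ultimately consider "A i = topspace T" | "?B = topspace T"
    using irr[unfolded irreducible_space_def, THEN conjunct2, rule_format, of "A i" ?B]
      insert.prems(1) by auto
  then show ?case
  proof cases
    case 2
    have "\<exists>i\<in>I. A i = topspace T"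
      by (rule insert.IH) (use insert.prems(1) 2 in simp_all)
    then show ?thesis by blast
  qed simp
qed

text \<open>The topological content of hypotheses (1) and (2). Commutation is asked on
  \<open>topspace T\<close> because \<open>mor_eq\<close> compares maps only there.\<close>

locale commuting_maps =
  fixes T :: "'a topology" and f g :: "'a \<Rightarrow> 'a" and S :: "'a set"
  assumes cont_f: "continuous_map T T f" and cont_g: "continuous_map T T g"
    and commute: "\<And>x. x \<in> topspace T \<Longrightarrow> f (g x) = g (f x)"
    and S: "S \<subseteq> topspace T" "f ` (g ` S) = S"
begin

lemma funpow_in: "x \<in> topspace T \<Longrightarrow> (f ^^ n) x \<in> topspace T"
    "x \<in> topspace T \<Longrightarrow> (g ^^ n) x \<in> topspace T"
  using continuous_map_funpow[OF cont_f, of n] continuous_map_funpow[OF cont_g, of n]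
  by (auto simp: continuous_map_def Pi_iff)

lemma funpow_commute:
  assumes "x \<in> topspace T"
  shows "(f ^^ a) ((g ^^ b) x) = (g ^^ b) ((f ^^ a) x)"
proof -
  have 1: "f ((g ^^ b) x) = (g ^^ b) (f x)" if "x \<in> topspace T" for x
    using that by (induction b) (simp_all add: commute funpow_in)
  show ?thesis
    using assms by (induction a) (simp_all add: 1 funpow_in)
qed

text \<open>On \<open>S\<close> the map is the \<open>n\<close>-th iterate of
  \<open>f \<circ> g\<close>, by commutation.\<close>

lemma funpow_image: "(f ^^ n) ` (g ^^ n) ` S = S"
proof (induction n)
  case (Suc n)
  have "(f ^^ Suc n) ((g ^^ Suc n) x) = f (g ((f ^^ n) ((g ^^ n) x)))" if "x \<in> S" for x
    using that S(1) funpow_commute[of "(g ^^ n) x" n 1] funpow_in(2) by auto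
  then have "(f ^^ Suc n) ` (g ^^ Suc n) ` S = f ` g ` (f ^^ n) ` (g ^^ n) ` S"
    unfolding image_image by (rule image_cong[OF refl])
  with Suc S(2) show ?case by simp
qed simp

text \<open>Move \<open>g ^^ n\<close> to the outside; the remaining \<open>i\<close> copies of
  \<open>f\<close> and of \<open>g\<close> cancel on \<open>S\<close>.\<close>

lemma funpow_image_add: "(f ^^ i) ` (g ^^ (n + i)) ` S = (g ^^ n) ` S"
proof -
  have "(f ^^ i) ((g ^^ (n + i)) x) = (g ^^ n) ((f ^^ i) ((g ^^ i) x))" if "x \<in> S" for x
    using that S(1) funpow_commute[of "(g ^^ i) x" i n] funpow_in(2) by (auto simp: funpow_add)
  then have "(f ^^ i) ` (g ^^ (n + i)) ` S = (g ^^ n) ` (f ^^ i) ` (g ^^ i) ` S"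
    unfolding image_image by (rule image_cong[OF refl])
  then show ?thesis by (simp add: funpow_image)
qed

text \<open>The closures of the \<open>(g ^^ (k * n)) ` S\<close> form a descending chain. Applying \<open>f ^^ (k * n)\<close>
  where it becomes stationary shows that \<open>(g ^^ n) ` S\<close> is dense in \<open>S\<close>; hence \<open>f ^^ n\<close> maps \<open>S\<close> into
  itself, and \<open>S = (g ^^ n) ` (f ^^ n) ` S\<close> gives the claim. In this way it is not needed that \<open>g\<close>
  is a closed map.\<close>

lemma invariant_imp_eq:
  assumes noeth: "noetherian_topology T" and closed: "closedin T S" and inv: "(g ^^ n) ` S \<subseteq> S"
  shows "(g ^^ n) ` S = S"
proof -
  define C where "C k = T closure_of ((g ^^ (k * n)) ` S)" for k
  have step: "(g ^^ (Suc k * n)) ` S \<subseteq> (g ^^ (k * n)) ` S" for k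
  proof -
    have "(g ^^ (Suc k * n)) ` S = (g ^^ (k * n)) ` (g ^^ n) ` S"
      by (simp add: image_comp add.commute flip: funpow_add)
    then show ?thesis using inv by auto
  qed
  have "\<And>k. closedin T (C k)" by (simp add: C_def)
  moreover have "\<And>k. C (Suc k) \<subseteq> C k"
    unfolding C_def by (intro closure_of_mono step)
  ultimately obtain k where k: "C (Suc k) = C k"
    using noetherian_topologyD[OF noeth] by metis
  have "S = (f ^^ (k * n)) ` (g ^^ (k * n)) ` S" by (simp add: funpow_image)
  also have "\<dots> \<subseteq> (f ^^ (k * n)) ` C k"
  proof -
    have "(g ^^ (k * n)) ` S \<subseteq> topspace T" using S(1) funpow_in(2) by auto
    then show ?thesis unfolding C_def by (intro image_mono closure_of_subset)
  qed
  \<comment> \<open>The stationary step trades \<open>k * n\<close> copies of \<open>g\<close> for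
    \<open>n + k * n\<close>, so that \<open>n\<close> of them survive the cancellation.\<close>
  also have "\<dots> = (f ^^ (k * n)) ` (T closure_of ((g ^^ (n + k * n)) ` S))"
    using k by (simp add: C_def)
  also have "\<dots> \<subseteq> T closure_of ((f ^^ (k * n)) ` (g ^^ (n + k * n)) ` S)"
    by (rule continuous_map_image_closure_subset[OF continuous_map_funpow[OF cont_f]])
  also have "\<dots> = T closure_of ((g ^^ n) ` S)" by (simp only: funpow_image_add)
  finally have dense: "S \<subseteq> T closure_of ((g ^^ n) ` S)" .
  have "(f ^^ n) ` S \<subseteq> (f ^^ n) ` (T closure_of ((g ^^ n) ` S))"
    using dense by (rule image_mono)
  also have "\<dots> \<subseteq> T closure_of ((f ^^ n) ` (g ^^ n) ` S)"
    by (rule continuous_map_image_closure_subset[OF continuous_map_funpow[OF cont_f]])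
  also have "\<dots> = S" using closed by (simp add: funpow_image closure_of_closedin)
  finally have "(g ^^ n) ` (f ^^ n) ` S \<subseteq> (g ^^ n) ` S" by (rule image_mono)
  \<comment> \<open>The left-hand side is thus all of \<open>S\<close>, which gives the inclusion
    opposite to \<open>inv\<close>.\<close>
  moreover have "(g ^^ n) ` (f ^^ n) ` S = (f ^^ n) ` (g ^^ n) ` S"
    unfolding image_image using S(1) by (intro image_cong) (auto simp: funpow_commute)
  ultimately show ?thesis using inv by (simp add: funpow_image)
qed

end

section \<open>Composition of morphisms\<close>

text \<open>The part of the presheaf axioms that is needed to compare germs. For \<open>Spec K\<close> it is immediate,
  because its restriction maps restrict functions.\<close>

definition functorial_restriction :: "('p, 'r) ringed_space \<Rightarrow> bool" where
  "functorial_restriction X \<longleftrightarrow>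
     (\<forall>U V W s. open_in X U \<and> open_in X V \<and> open_in X W \<and> W \<subseteq> V \<and> V \<subseteq> U \<and>
        s \<in> carrier (sections X U) \<longrightarrow>
        restriction X V W (restriction X U V s) = restriction X U W s)"

lemma functorial_restrictionD:
  assumes "functorial_restriction X" "open_in X U" "open_in X V" "open_in X W" "W \<subseteq> V" "V \<subseteq> U"
    "s \<in> carrier (sections X U)"
  shows "restriction X V W (restriction X U V s) = restriction X U W s"
  using assms unfolding functorial_restriction_def by blast

lemma functorial_restriction_presheaf: "presheaf_of_rings X \<Longrightarrow> functorial_restriction X"
  unfolding presheaf_of_rings_def functorial_restriction_def by blast

lemma functorial_restriction_Spec: "functorial_restriction (Spec R)"
  unfolding functorial_restriction_def Spec_def fraction_space_def
  by (auto simp: restrict_def fun_eq_iff)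

text \<open>Germs are sets of representatives, so two symmetric inclusions are needed: a
  representative matched over \<open>B\<close> is also matched over \<open>B \<inter> W\<close>,
  where \<open>s\<close> and \<open>t\<close> agree.\<close>

lemma germ_eqI:
  assumes X: "functorial_restriction X"
    and s: "open_in X U" "s \<in> carrier (sections X U)"
    and t: "open_in X V" "t \<in> carrier (sections X V)"
    and W: "open_in X W" "p \<in> W" "W \<subseteq> U \<inter> V" "restriction X U W s = restriction X V W t"
  shows "germ X p U s = germ X p V t"
proof -
  have *: "germ X p U s \<subseteq> germ X p V t"
    if st: "open_in X U" "s \<in> carrier (sections X U)" "open_in X V" "t \<in> carrier (sections X V)"
      "W \<subseteq> U \<inter> V" "restriction X U W s = restriction X V W t" for U V s t
  proof
    fix c assume "c \<in> germ X p U s"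
    then obtain A a B where A: "c = (A, a)" "open_in X A" "p \<in> A" "a \<in> carrier (sections X A)"
      "open_in X B" "p \<in> B" "B \<subseteq> U \<inter> A" "restriction X U B s = restriction X A B a"
      by (auto simp: germ_def)
    have o: "open_in X (B \<inter> W)" using A W by (simp add: openin_Int)
    have "restriction X V (B \<inter> W) t = restriction X W (B \<inter> W) (restriction X V W t)"
      using functorial_restrictionD[OF X st(3) W(1) o _ _ st(4)] st(5) by simp
    also have "\<dots> = restriction X W (B \<inter> W) (restriction X U W s)" using st(6) by simp
    also have "\<dots> = restriction X U (B \<inter> W) s"
      using functorial_restrictionD[OF X st(1) W(1) o _ _ st(2)] st(5) by simp
    also have "\<dots> = restriction X B (B \<inter> W) (restriction X U B s)"
      using functorial_restrictionD[OF X st(1) A(5) o _ _ st(2)] A(7) by simp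
    also have "\<dots> = restriction X B (B \<inter> W) (restriction X A B a)" using A(8) by simp
    also have "\<dots> = restriction X A (B \<inter> W) a"
      using functorial_restrictionD[OF X A(2) A(5) o _ _ A(4)] A(7) by simp
    finally have "restriction X V (B \<inter> W) t = restriction X A (B \<inter> W) a" .
    moreover have "B \<inter> W \<subseteq> V \<inter> A" "p \<in> B \<inter> W" using st(5) A(6,7) W(2) by auto
    ultimately show "c \<in> germ X p V t" unfolding germ_def using A o by auto
  qed
  show ?thesis
    using *[OF s t W(3,4)] *[OF t s _ W(4)[symmetric]] W(3) by blast
qed

lemma germ_self: "open_in X U \<Longrightarrow> p \<in> U \<Longrightarrow> s \<in> carrier (sections X U) \<Longrightarrow> (U, s) \<in> germ X p U s"
  by (auto simp: germ_def)

text \<open>\<open>lrs_morphism\<close> without locality on stalks, so that stalk maps can be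
  computed before locality of a composite is addressed.\<close>

definition presheaf_morphism ::
  "('p, 'r) ringed_space \<Rightarrow> ('q, 't) ringed_space \<Rightarrow> ('p, 'r, 'q, 't) lrs_mor \<Rightarrow> bool" where
  "presheaf_morphism X Y \<phi> \<longleftrightarrow>
     continuous_map (top_space X) (top_space Y) (mor_pt \<phi>) \<and>
     (\<forall>V. open_in Y V \<longrightarrow>
        mor_sec \<phi> V \<in> ring_hom (sections Y V) (sections X (preim X (mor_pt \<phi>) V))) \<and>
     (\<forall>V W. open_in Y V \<and> open_in Y W \<and> W \<subseteq> V \<longrightarrow> (\<forall>t\<in>carrier (sections Y V).
        mor_sec \<phi> W (restriction Y V W t) =
        restriction X (preim X (mor_pt \<phi>) V) (preim X (mor_pt \<phi>) W) (mor_sec \<phi> V t)))"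

lemma lrs_morphism_iff:
  "lrs_morphism X Y \<phi> \<longleftrightarrow> presheaf_morphism X Y \<phi> \<and>
     (\<forall>p\<in>points X. local_hom (stalk Y (mor_pt \<phi> p)) (stalk X p) (stalk_map X \<phi> p))"
  by (auto simp: lrs_morphism_def presheaf_morphism_def)

lemma presheaf_morphismD:
  assumes "presheaf_morphism X Y \<phi>"
  shows "continuous_map (top_space X) (top_space Y) (mor_pt \<phi>)"
    and "open_in Y V \<Longrightarrow>
      mor_sec \<phi> V \<in> ring_hom (sections Y V) (sections X (preim X (mor_pt \<phi>) V))"
    and "open_in Y V \<Longrightarrow> open_in Y W \<Longrightarrow> W \<subseteq> V \<Longrightarrow> t \<in> carrier (sections Y V) \<Longrightarrow>
      mor_sec \<phi> W (restriction Y V W t) =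
      restriction X (preim X (mor_pt \<phi>) V) (preim X (mor_pt \<phi>) W) (mor_sec \<phi> V t)"
    and "open_in Y V \<Longrightarrow> open_in X (preim X (mor_pt \<phi>) V)"
    and "p \<in> points X \<Longrightarrow> mor_pt \<phi> p \<in> points Y"
    and "open_in Y V \<Longrightarrow> t \<in> carrier (sections Y V) \<Longrightarrow>
      mor_sec \<phi> V t \<in> carrier (sections X (preim X (mor_pt \<phi>) V))"
  subgoal using assms by (simp add: presheaf_morphism_def)
  subgoal using assms by (simp add: presheaf_morphism_def)
  subgoal using assms unfolding presheaf_morphism_def by blast
  subgoal using assms openin_continuous_map_preimage[of "top_space X" "top_space Y" "mor_pt \<phi>" V]
    by (simp add: presheaf_morphism_def preim_def)
  subgoal using assms by (auto simp: presheaf_morphism_def continuous_map_def)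
  subgoal using assms unfolding presheaf_morphism_def by (blast intro: ring_hom_closed)
  done

text \<open>All representatives contribute the same germ, so the union in \<open>stalk_map\<close>
  collapses to one member.\<close>

lemma stalk_map_germ:
  assumes X: "functorial_restriction X" and \<phi>: "presheaf_morphism X Y \<phi>" and p: "p \<in> points X"
    and t: "open_in Y V" "mor_pt \<phi> p \<in> V" "t \<in> carrier (sections Y V)"
  shows "stalk_map X \<phi> p (germ Y (mor_pt \<phi> p) V t)
       = germ X p (preim X (mor_pt \<phi>) V) (mor_sec \<phi> V t)"
proof -
  have "germ X p (preim X (mor_pt \<phi>) V') (mor_sec \<phi> V' t')
      = germ X p (preim X (mor_pt \<phi>) V) (mor_sec \<phi> V t)"
    if g: "(V', t') \<in> germ Y (mor_pt \<phi> p) V t" for V' t'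
  proof -
    obtain W where t': "open_in Y V'" "t' \<in> carrier (sections Y V')"
      and W: "open_in Y W" "mor_pt \<phi> p \<in> W" "W \<subseteq> V \<inter> V'"
        "restriction Y V W t = restriction Y V' W t'"
      using g by (auto simp: germ_def)
    show ?thesis
    proof (rule germ_eqI[OF X])
      show "p \<in> preim X (mor_pt \<phi>) W" using p W by (simp add: preim_def)
      show "preim X (mor_pt \<phi>) W \<subseteq> preim X (mor_pt \<phi>) V' \<inter> preim X (mor_pt \<phi>) V"
        using W by (auto simp: preim_def)
      show "restriction X (preim X (mor_pt \<phi>) V') (preim X (mor_pt \<phi>) W) (mor_sec \<phi> V' t')
          = restriction X (preim X (mor_pt \<phi>) V) (preim X (mor_pt \<phi>) W) (mor_sec \<phi> V t)"
        using presheaf_morphismD(3)[OF \<phi> t(1) W(1) _ t(3)] presheaf_morphismD(3)[OF \<phi> t'(1) W(1) _ t'(2)] W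
        by simp
    qed (simp_all add: presheaf_morphismD(4,6)[OF \<phi>] t t' W)
  qed
  moreover have "(V, t) \<in> germ Y (mor_pt \<phi> p) V t" using t by (simp add: germ_self)
  ultimately show ?thesis unfolding stalk_map_def by blast
qed

lemma ring_hom_cong_carrier:
  assumes "cring R" "h \<in> ring_hom R S" "\<And>a. a \<in> carrier R \<Longrightarrow> h' a = h a"
  shows "h' \<in> ring_hom R S"
proof -
  interpret cring R by fact
  show ?thesis
    using assms(2,3) unfolding ring_hom_def by auto
qed

text \<open>The maximal ideal of \<open>S\<close> links the two pullbacks. Agreement of
  \<open>h'\<close> with the composite is asked only on the carrier, as stalk maps are controlled
  only on germs.\<close>

lemma local_hom_comp:
  assumes R: "cring R" and S: "local_ring S"
    and h: "local_hom R S h" and k: "local_hom S T k"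
    and eq: "\<And>a. a \<in> carrier R \<Longrightarrow> h' a = k (h a)"
  shows "local_hom R T h'"
  unfolding local_hom_def
proof (intro conjI allI impI)
  have hom: "h \<in> ring_hom R S" "k \<in> ring_hom S T" using h k by (auto simp: local_hom_def)
  then show "h' \<in> ring_hom R T"
    using ring_hom_cong_carrier[OF R ring_hom_trans[OF hom]] eq by simp
  fix m n assume mn: "maximalideal m R \<and> maximalideal n T"
  obtain l where l: "maximalideal l S" using S by (auto simp: local_ring_def)
  have "{b \<in> carrier S. k b \<in> n} = l" "{a \<in> carrier R. h a \<in> l} = m"
    using h k l mn by (auto simp: local_hom_def)
  then show "{a \<in> carrier R. h' a \<in> n} = m"
    using eq ring_hom_closed[OF hom(1)] by auto
qed

lemma preim_mor_comp:
  assumes "presheaf_morphism X Y \<phi>"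
  shows "preim X (mor_pt (mor_comp Y \<psi> \<phi>)) V = preim X (mor_pt \<phi>) (preim Y (mor_pt \<psi>) V)"
  using presheaf_morphismD(5)[OF assms] by (auto simp: preim_def mor_comp_def)

lemma presheaf_morphism_mor_comp:
  assumes \<phi>: "presheaf_morphism X Y \<phi>" and \<psi>: "presheaf_morphism Y Z \<psi>"
  shows "presheaf_morphism X Z (mor_comp Y \<psi> \<phi>)"
  unfolding presheaf_morphism_def preim_mor_comp[OF \<phi>]
proof (intro conjI allI impI ballI)
  have pt: "mor_pt (mor_comp Y \<psi> \<phi>) = mor_pt \<psi> \<circ> mor_pt \<phi>"
    and sec: "\<And>W. mor_sec (mor_comp Y \<psi> \<phi>) W = mor_sec \<phi> (preim Y (mor_pt \<psi>) W) \<circ> mor_sec \<psi> W"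
    by (simp_all add: mor_comp_def)
  note op = presheaf_morphismD(4)[OF \<psi>]
  show "continuous_map (top_space X) (top_space Z) (mor_pt (mor_comp Y \<psi> \<phi>))"
    unfolding pt
    by (rule continuous_map_compose[OF presheaf_morphismD(1)[OF \<phi>] presheaf_morphismD(1)[OF \<psi>]])
  show "mor_sec (mor_comp Y \<psi> \<phi>) V
      \<in> ring_hom (sections Z V) (sections X (preim X (mor_pt \<phi>) (preim Y (mor_pt \<psi>) V)))"
    if "open_in Z V" for V
    unfolding sec
    by (rule ring_hom_trans[OF presheaf_morphismD(2)[OF \<psi> that] presheaf_morphismD(2)[OF \<phi> op[OF that]]])
  fix V W t
  assume VW: "open_in Z V \<and> open_in Z W \<and> W \<subseteq> V" and t: "t \<in> carrier (sections Z V)"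
  then have V: "open_in Z V" and W: "open_in Z W" and sub: "W \<subseteq> V" by auto
  have sub': "preim Y (mor_pt \<psi>) W \<subseteq> preim Y (mor_pt \<psi>) V" using sub by (auto simp: preim_def)
  show "mor_sec (mor_comp Y \<psi> \<phi>) W (restriction Z V W t) =
        restriction X (preim X (mor_pt \<phi>) (preim Y (mor_pt \<psi>) V))
          (preim X (mor_pt \<phi>) (preim Y (mor_pt \<psi>) W)) (mor_sec (mor_comp Y \<psi> \<phi>) V t)"
    unfolding sec comp_apply presheaf_morphismD(3)[OF \<psi> V W sub t]
    by (rule presheaf_morphismD(3)[OF \<phi> op[OF V] op[OF W] sub' presheaf_morphismD(6)[OF \<psi> V t]])
qed

lemma functorial_restriction_lrs: "locally_ringed_space X \<Longrightarrow> functorial_restriction X"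
  by (simp add: locally_ringed_space_def sheaf_of_rings_def functorial_restriction_presheaf)

lemma stalk_map_mor_comp:
  assumes X: "functorial_restriction X" and Y: "functorial_restriction Y"
    and \<phi>: "presheaf_morphism X Y \<phi>" and \<psi>: "presheaf_morphism Y Z \<psi>"
    and p: "p \<in> points X" and c: "c \<in> carrier (stalk Z (mor_pt \<psi> (mor_pt \<phi> p)))"
  shows "stalk_map X (mor_comp Y \<psi> \<phi>) p c = stalk_map X \<phi> p (stalk_map Y \<psi> (mor_pt \<phi> p) c)"
proof -
  let ?q = "mor_pt \<phi> p"
  have q: "?q \<in> points Y" using p presheaf_morphismD(5)[OF \<phi>] by simp
  obtain V t where c: "c = germ Z (mor_pt \<psi> ?q) V t" and t: "open_in Z V" "mor_pt \<psi> ?q \<in> V"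
    "t \<in> carrier (sections Z V)"
    using c by (auto simp: stalk_def)
  have "stalk_map X \<phi> p (stalk_map Y \<psi> ?q c)
      = germ X p (preim X (mor_pt \<phi>) (preim Y (mor_pt \<psi>) V))
          (mor_sec \<phi> (preim Y (mor_pt \<psi>) V) (mor_sec \<psi> V t))"
    unfolding c stalk_map_germ[OF Y \<psi> q t]
    using q t by (intro stalk_map_germ[OF X \<phi> p] presheaf_morphismD(4,6)[OF \<psi>])
      (simp_all add: preim_def)
  also have "\<dots> = germ X p (preim X (mor_pt (mor_comp Y \<psi> \<phi>)) V) (mor_sec (mor_comp Y \<psi> \<phi>) V t)"
    unfolding preim_mor_comp[OF \<phi>] by (simp add: mor_comp_def)
  also have "\<dots> = stalk_map X (mor_comp Y \<psi> \<phi>) p c"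
    using stalk_map_germ[OF X presheaf_morphism_mor_comp[OF \<phi> \<psi>] p t(1) _ t(3)] t(2)
    by (simp add: c mor_comp_def)
  finally show ?thesis ..
qed

text \<open>The source enters through \<open>functorial_restriction\<close> since it will be
  \<open>Spec K\<close>; the middle stalk must be local for \<open>local_hom_comp\<close>.\<close>

lemma lrs_morphism_mor_comp:
  assumes X: "functorial_restriction X" and Y: "locally_ringed_space Y"
    and Z: "locally_ringed_space Z"
    and \<phi>: "lrs_morphism X Y \<phi>" and \<psi>: "lrs_morphism Y Z \<psi>"
  shows "lrs_morphism X Z (mor_comp Y \<psi> \<phi>)"
  unfolding lrs_morphism_iff
proof (intro conjI ballI)
  have \<phi>': "presheaf_morphism X Y \<phi>" and \<psi>': "presheaf_morphism Y Z \<psi>"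
    using \<phi> \<psi> by (auto simp: lrs_morphism_iff)
  then show "presheaf_morphism X Z (mor_comp Y \<psi> \<phi>)" by (rule presheaf_morphism_mor_comp)
  fix p assume p: "p \<in> points X"
  have q: "mor_pt \<phi> p \<in> points Y" using p presheaf_morphismD(5)[OF \<phi>'] by simp
  have r: "mor_pt \<psi> (mor_pt \<phi> p) \<in> points Z" using q presheaf_morphismD(5)[OF \<psi>'] by simp
  have "local_hom (stalk Z (mor_pt \<psi> (mor_pt \<phi> p))) (stalk X p)
      (stalk_map X (mor_comp Y \<psi> \<phi>) p)"
  proof (rule local_hom_comp)
    show "cring (stalk Z (mor_pt \<psi> (mor_pt \<phi> p)))"
      using Z r by (simp add: locally_ringed_space_def local_ring_def)
    show "local_ring (stalk Y (mor_pt \<phi> p))"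
      using Y q by (simp add: locally_ringed_space_def)
    show "local_hom (stalk Z (mor_pt \<psi> (mor_pt \<phi> p))) (stalk Y (mor_pt \<phi> p))
        (stalk_map Y \<psi> (mor_pt \<phi> p))"
      using \<psi> q by (simp add: lrs_morphism_iff)
    show "local_hom (stalk Y (mor_pt \<phi> p)) (stalk X p) (stalk_map X \<phi> p)"
      using \<phi> p by (simp add: lrs_morphism_iff)
  qed (rule stalk_map_mor_comp[OF X functorial_restriction_lrs[OF Y] \<phi>' \<psi>' p])
  then show "local_hom (stalk Z (mor_pt (mor_comp Y \<psi> \<phi>) p)) (stalk X p)
      (stalk_map X (mor_comp Y \<psi> \<phi>) p)"
    by (simp add: mor_comp_def)
qed

section \<open>Images of \<open>K\<close>-points\<close>

text \<open>Associativity: \<open>\<rho>\<close> after \<open>\<phi>\<close> after \<open>x\<close>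
  is \<open>\<pi>\<close> after \<open>x\<close>, the identity. It serves both for \<open>j\<close>
  from \<open>Y\<close> to \<open>X\<close> and for \<open>g\<close> on \<open>X\<close>.\<close>

lemma K_points_mor_comp:
  assumes X: "locally_ringed_space X" and Y: "locally_ringed_space Y"
    and x: "x \<in> K_points K X \<pi>" and \<phi>: "lrs_morphism X Y \<phi>"
    and \<pi>: "mor_eq X (Spec K) (mor_comp Y \<rho> \<phi>) \<pi>" and \<rho>: "lrs_morphism Y (Spec K) \<rho>"
  shows "mor_comp X \<phi> x \<in> K_points K Y \<rho>"
proof -
  have xm: "lrs_morphism (Spec K) X x" and xe: "mor_eq (Spec K) (Spec K) (mor_comp X \<pi> x) mor_id"
    using x by (auto simp: K_points_def morphism_over_def)
  then have x': "presheaf_morphism (Spec K) X x" and \<phi>': "presheaf_morphism X Y \<phi>"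
    using \<phi> by (auto simp: lrs_morphism_iff)
  have "mor_eq (Spec K) (Spec K) (mor_comp Y \<rho> (mor_comp X \<phi> x)) mor_id"
    unfolding mor_eq_def
  proof (intro conjI ballI allI impI)
    fix p assume p: "p \<in> points (Spec K)"
    then have "mor_pt x p \<in> points X" by (rule presheaf_morphismD(5)[OF x'])
    then have "mor_pt \<rho> (mor_pt \<phi> (mor_pt x p)) = mor_pt \<pi> (mor_pt x p)"
      using \<pi> by (simp add: mor_eq_def mor_comp_def)
    then show "mor_pt (mor_comp Y \<rho> (mor_comp X \<phi> x)) p = mor_pt mor_id p"
      using xe p by (simp add: mor_eq_def mor_comp_def mor_id_def)
  next
    fix V t assume V: "open_in (Spec K) V" and t: "t \<in> carrier (sections (Spec K) V)"
    \<comment> \<open>Maps on sections are indexed by open sets, so the two descriptions of the open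
      set at which \<open>mor_sec x\<close> is taken must be identified.\<close>
    have "preim X (mor_pt \<pi>) V = preim X (mor_pt (mor_comp Y \<rho> \<phi>)) V"
      using \<pi> by (auto simp: preim_def mor_eq_def)
    also have "\<dots> = preim X (mor_pt \<phi>) (preim Y (mor_pt \<rho>) V)"
      by (rule preim_mor_comp[OF \<phi>'])
    finally have pre: "preim X (mor_pt \<pi>) V = preim X (mor_pt \<phi>) (preim Y (mor_pt \<rho>) V)" .
    have "mor_sec \<phi> (preim Y (mor_pt \<rho>) V) (mor_sec \<rho> V t) = mor_sec \<pi> V t"
      using \<pi> V t by (simp add: mor_eq_def mor_comp_def)
    moreover have "mor_sec x (preim X (mor_pt \<pi>) V) (mor_sec \<pi> V t) = t"
      using xe V t by (simp add: mor_eq_def mor_comp_def mor_id_def)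
    ultimately show "mor_sec (mor_comp Y \<rho> (mor_comp X \<phi> x)) V t = mor_sec mor_id V t"
      using pre by (simp add: mor_comp_def mor_id_def)
  qed
  moreover have "lrs_morphism (Spec K) Y (mor_comp X \<phi> x)"
    by (rule lrs_morphism_mor_comp[OF functorial_restriction_Spec X Y xm \<phi>])
  ultimately show ?thesis by (simp add: K_points_def morphism_over_def)
qed

lemma K_points_funpow:
  assumes X: "locally_ringed_space X" and g: "morphism_over K X \<pi> X \<pi> g"
    and \<pi>: "lrs_morphism X (Spec K) \<pi>" and x: "x \<in> K_points K X \<pi>"
  shows "\<exists>x'\<in>K_points K X \<pi>. mor_pt x' = (mor_pt g ^^ n) \<circ> mor_pt x"
proof (induction n)
  case 0
  show ?case using x by auto
next
  case (Suc n)
  then obtain x' where x': "x' \<in> K_points K X \<pi>" "mor_pt x' = (mor_pt g ^^ n) \<circ> mor_pt x"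
    by blast
  have "mor_comp X g x' \<in> K_points K X \<pi>"
    using g by (intro K_points_mor_comp[OF X X x'(1) _ _ \<pi>]) (auto simp: morphism_over_def)
  moreover have "mor_pt (mor_comp X g x') = (mor_pt g ^^ Suc n) \<circ> mor_pt x"
    by (simp add: mor_comp_def x'(2) comp_assoc)
  ultimately show ?case by blast
qed

text \<open>A field has only the two trivial ideals. Hence a \<open>K\<close>-point has at most one
  image point, and failing to lie in a set means avoiding it.\<close>

lemma points_Spec_field:
  fixes K :: "'k ring"
  assumes "field K" "p \<in> points (Spec K)" "q \<in> points (Spec K)"
  shows "p = q"
proof -
  interpret field K by fact
  have sub: "points (Spec K) \<subseteq> {p. primeideal p K}"
  proof -
    have "openin (zariski {p. primeideal p K} (carrier K)) U
        \<longleftrightarrow> (\<exists>E\<subseteq>carrier K. U = {p \<in> {p. primeideal p K}. \<not> E \<subseteq> p})" for U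
      by (rule openin_zariski[where R = K]) auto
    then show ?thesis by (auto simp: Spec_def fraction_space_def topspace_def)
  qed
  have "r = {\<zero>\<^bsub>K\<^esub>}" if "r \<in> points (Spec K)" for r
  proof -
    have r: "primeideal r K" using sub that by auto
    then have "r \<in> {{\<zero>\<^bsub>K\<^esub>}, carrier K}"
      using all_ideals primeideal.axioms(1) by blast
    then show ?thesis using primeideal.I_notcarr[OF r] by auto
  qed
  then show ?thesis using assms by metis
qed

theorem proposition4p2:
  fixes K :: "'k ring"
    and X :: "('p, 'r) ringed_space" and \<pi> :: "('p, 'r, 'k) structure_mor"
    and f g :: "('p, 'r, 'p, 'r) lrs_mor"
    and Y :: "('q, 't) ringed_space" and j :: "('q, 't, 'p, 'r) lrs_mor"
  assumes "number_field K"
    and "projective_variety K X \<pi>"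
    and "morphism_over K X \<pi> X \<pi> f" and "surjective_morphism X X f"
    and "morphism_over K X \<pi> X \<pi> g" and "surjective_morphism X X g"
    and "closed_subvariety X Y j"
    and "mor_eq X X (mor_comp X f g) (mor_comp X g f)"
    and "mor_pt f ` (mor_pt g ` subscheme_points Y j) = subscheme_points Y j"
    and "\<And>n::nat. n \<ge> 1 \<Longrightarrow>
           subscheme_points Y j \<inter> (mor_pt g ^^ n) ` subscheme_points Y j \<subset> subscheme_points Y j"
    and "K_points_dense K Y (mor_comp X \<pi> j)"
  shows "\<not> (\<exists>s0::nat. \<forall>s\<ge>s0.
           K_points_in K X \<pi>
             (preim X (mor_pt f ^^ (s + 1)) (subscheme_points Y j) -
              (\<Union>i\<in>{0..s}. preim X (mor_pt f ^^ i) (subscheme_points Y j))) = {})"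
proof
  let ?S = "subscheme_points Y j"
  let ?T = "top_space X"
  assume "\<exists>s0::nat. \<forall>s\<ge>s0. K_points_in K X \<pi>
      (preim X (mor_pt f ^^ (s + 1)) ?S - (\<Union>i\<in>{0..s}. preim X (mor_pt f ^^ i) ?S)) = {}"
  then obtain s where empty: "K_points_in K X \<pi>
      (preim X (mor_pt f ^^ (s + 1)) ?S - (\<Union>i\<in>{0..s}. preim X (mor_pt f ^^ i) ?S)) = {}"
    by blast
  have K: "field K" using assms(1) by (simp add: number_field_def)
  have X: "locally_ringed_space X" and \<pi>: "lrs_morphism X (Spec K) \<pi>"
    using assms(2) by (auto simp: projective_variety_def projective_over_def scheme_over_def scheme_def)
  have Y: "locally_ringed_space Y" and j: "lrs_morphism Y X j" and irr: "irreducible_space (top_space Y)"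
    and closed: "closedin ?T ?S"
    using assms(7) by (auto simp: closed_subvariety_def closed_immersion_def reduced_scheme_def
        scheme_def subscheme_points_def)
  have f: "continuous_map ?T ?T (mor_pt f)" and g: "continuous_map ?T ?T (mor_pt g)"
    and jc: "continuous_map (top_space Y) ?T (mor_pt j)"
    using assms(3,5) j by (auto simp: morphism_over_def lrs_morphism_def)
  have noeth: "noetherian_topology ?T"
  proof -
    obtain n \<iota> where "closed_immersion X (projective_space K n) \<iota>"
      using assms(2) by (auto simp: projective_variety_def projective_over_def)
    then show ?thesis
      using noetherian_topology_closed_embedding[OF noetherian_projective_space[OF K]]
      by (auto simp: closed_immersion_def)
  qed
  interpret commuting_maps ?T "mor_pt f" "mor_pt g" ?S
  proof
    show "mor_pt f (mor_pt g x) = mor_pt g (mor_pt f x)" if "x \<in> points X" for x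
      using assms(8) that by (simp add: mor_eq_def mor_comp_def)
    show "?S \<subseteq> points X" using closed by (rule closedin_subset)
  qed (use f g assms(9) in simp_all)
  \<comment> \<open>Otherwise \<open>g ^^ n\<close> would map \<open>S\<close> onto itself, and the
    intersection in (3) would be all of \<open>S\<close>.\<close>
  have not_inv: "\<not> (mor_pt g ^^ n) ` ?S \<subseteq> ?S" if "n \<ge> 1" for n
    using invariant_imp_eq[OF noeth closed] assms(10)[OF that] by blast

  \<comment> \<open>The locus of points \<open>y\<close> of \<open>Y\<close> for which the iterate
    \<open>f ^^ i\<close> returns \<open>g ^^ (s + 1)\<close> of the image of \<open>y\<close> to
    \<open>S\<close>.\<close>
  define A where "A i = {y \<in> points Y. (mor_pt f ^^ i) ((mor_pt g ^^ (s + 1)) (mor_pt j y)) \<in> ?S}" for i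
  have A_closed: "closedin (top_space Y) (A i)" for i
  proof -
    have "continuous_map (top_space Y) ?T
        ((mor_pt f ^^ i) \<circ> ((mor_pt g ^^ (s + 1)) \<circ> mor_pt j))"
      by (rule continuous_map_compose[OF continuous_map_compose[OF jc continuous_map_funpow[OF g]]
            continuous_map_funpow[OF f]])
    from closedin_continuous_map_preimage[OF this closed] show ?thesis
      by (simp add: A_def)
  qed
  have K_points_A: "mor_pt y p \<in> (\<Union>i\<in>{0..s}. A i)"
    if y: "y \<in> K_points K Y (mor_comp X \<pi> j)" and p: "p \<in> points (Spec K)" for y p
  proof -
    \<comment> \<open>The structure morphism of \<open>Y\<close> is \<open>\<pi>\<close> after
      \<open>j\<close> by choice, so \<open>j\<close> is trivially a morphism over
      \<open>K\<close>.\<close>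
    have "mor_eq Y (Spec K) (mor_comp X \<pi> j) (mor_comp X \<pi> j)" by (simp add: mor_eq_def)
    then have "mor_comp Y j y \<in> K_points K X \<pi>"
      using K_points_mor_comp[OF Y X y j _ \<pi>] by simp
    then obtain x where x: "x \<in> K_points K X \<pi>"
      and "mor_pt x = (mor_pt g ^^ (s + 1)) \<circ> mor_pt (mor_comp Y j y)"
      using K_points_funpow[OF X assms(5) \<pi>] by blast
    then have xp: "mor_pt x q = (mor_pt g ^^ (s + 1)) (mor_pt j (mor_pt y q))" for q
      by (simp add: mor_comp_def)
    have "presheaf_morphism (Spec K) Y y" "presheaf_morphism (Spec K) X x"
      using x y by (auto simp: K_points_def morphism_over_def lrs_morphism_iff)
    then have yp: "mor_pt y p \<in> points Y" and xX: "mor_pt x p \<in> points X"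
      using p by (auto dest: presheaf_morphismD(5))
    have "mor_pt j (mor_pt y p) \<in> ?S" using yp by (auto simp: subscheme_points_def)
    then have "(mor_pt f ^^ (s + 1)) (mor_pt x p) \<in> (mor_pt f ^^ (s + 1)) ` (mor_pt g ^^ (s + 1)) ` ?S"
      unfolding xp by blast
    then have "mor_pt x p \<in> preim X (mor_pt f ^^ (s + 1)) ?S"
      unfolding funpow_image using xX by (simp add: preim_def)
    moreover have "\<not> mor_pt x ` points (Spec K) \<subseteq>
        preim X (mor_pt f ^^ (s + 1)) ?S - (\<Union>i\<in>{0..s}. preim X (mor_pt f ^^ i) ?S)"
      using empty x by (auto simp: K_points_in_def)
    \<comment> \<open>\<open>K_points_in\<close> constrains the whole image of
      \<open>Spec K\<close>; uniqueness of its point turns non-inclusion into a statement about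
      \<open>p\<close>.\<close>
    then have "mor_pt x p \<notin>
        preim X (mor_pt f ^^ (s + 1)) ?S - (\<Union>i\<in>{0..s}. preim X (mor_pt f ^^ i) ?S)"
      using points_Spec_field[OF K p] by blast
    ultimately obtain i where "i \<in> {0..s}" "mor_pt x p \<in> preim X (mor_pt f ^^ i) ?S" by blast
    with yp show ?thesis unfolding A_def preim_def xp by blast
  qed
  have "closedin (top_space Y) (\<Union>i\<in>{0..s}. A i)"
    using A_closed by (intro closedin_Union) auto
  then have "top_space Y closure_of
      (\<Union>y\<in>K_points K Y (mor_comp X \<pi> j). mor_pt y ` points (Spec K)) \<subseteq> (\<Union>i\<in>{0..s}. A i)"
    using K_points_A by (intro closure_of_minimal) blast+
  then have "points Y \<subseteq> (\<Union>i\<in>{0..s}. A i)"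
    using assms(11) by (simp add: K_points_dense_def)
  then have "points Y = (\<Union>i\<in>{0..s}. A i)" by (auto simp: A_def)
  then obtain i where i: "i \<le> s" "A i = points Y"
    using irreducible_space_finite_Union[OF irr _ A_closed, of "{0..s}" "\<lambda>i. i"] by auto
  \<comment> \<open>Here \<open>i \<le> s\<close> lets \<open>s + 1\<close> be written as
    \<open>n + i\<close> with \<open>n = s + 1 - i\<close> at least 1, the range covered by
    \<open>not_inv\<close>.\<close>
  have "(mor_pt f ^^ i) ` (mor_pt g ^^ (s + 1 - i + i)) ` ?S \<subseteq> ?S"
  proof -
    have "s + 1 - i + i = s + 1" using i(1) by simp
    then show ?thesis using i(2) by (auto simp: A_def subscheme_points_def simp del: funpow.simps)
  qed
  then have "(mor_pt g ^^ (s + 1 - i)) ` ?S \<subseteq> ?S" by (simp only: funpow_image_add)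
  with not_inv[of "s + 1 - i"] i(1) show False by simp
qed

end
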